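(* Let $N\geq 1$, let $\mathcal{H}$ be a Hilbert space and let $\mathcal{K}=\bigotimes_{i=1}^N\mathcal{K}_i$ be a tensor product of $N$ Hilbert spaces. Let $\psi_0,\psi_1$ be orthogonal unit vectors in $\mathcal{H}$ and let $\tau\in\mathcal{T}(\mathcal{K})$ be a state on $\mathcal{K}$. Let $U:\mathcal{K}\otimes\mathcal{H}\to\mathcal{K}\otimes\mathcal{H}$ be unitary and define $T:\mathcal{T}(\mathcal{H})\to\mathcal{T}(\mathcal{K}\otimes\mathcal{H})$ by $T(\rho)=U(\tau\otimes\rho)U^*$. Let $\tilde B$ be a macroscopic observable in $B(\mathcal{K})$ and define $B:=\tilde B\otimes\mathbf 1$. For $j=0,1$ denote by $b_j$ and $\sigma_j^2$ the expected value and variance of $B$ in the state $T(|\psi_j\rangle\langle\psi_j|)$, and suppose that $b_0\ne b_1$. Then for all $\psi=\alpha_0\psi_0+\alpha_1\psi_1$ with $|\alpha_0|^2+|\alpha_1|^2=1$ and for all microscopic and all macroscopic observables $A\in B(\mathcal{K}\otimes\mathcal{H})$, $$\Bigl|\operatorname{tr}\bigl(T(|\psi\rangle\langle\psi|)A\bigr)-\operatorname{tr}\Bigl(T\bigl(|\alpha_0|^2|\psi_0\rangle\langle\psi_0|+|\alpha_1|^2|\psi_1\rangle\langle\psi_1|\bigr)A\Bigr)\Bigr|\le\frac{\frac{2}{N}\|B\|+\sigma_0+\sigma_1}{|b_0-b_1|}\,\|A\|.$$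
   Context: $B(\mathcal{K})$ is the algebra of bounded operators, $\mathcal{T}(\mathcal{K})$ the space of trace class operators; a state is a positive trace class operator of trace $1$; observables are bounded self-adjoint operators. The expected value of $B$ in a state $\theta$ is $\operatorname{tr}(\theta B)$, its variance is $\operatorname{tr}(\theta B^2)-\operatorname{tr}(\theta B)^2$, and $\sigma_j\geq0$. For a system $\bigotimes_{i\in I}\mathcal{K}_i$ with $|I|$ (finitely many) tensor factors: an observable $X$ is microscopic if it acts nontrivially on at most one factor, i.e. $X=\mathbf 1\otimes\cdots\otimes\mathbf 1\otimes X_i\otimes\mathbf 1\otimes\cdots\otimes\mathbf 1$ for some $i\in I$ and some (self-adjoint) $X_i\in B(\mathcal{K}_i)$; one identifies $X_i$ with $X$. An observable $Y$ is macroscopic if $Y=\frac{1}{|I|}\sum_{i\in I}Y_i$ with (self-adjoint) $Y_i\in B(\mathcal{K}_i)$ such that $\|Y_i\|\le\|Y\|$ for all $i$. For $B(\mathcal{K})$ the factors are $\mathcal{K}_1,\dots,\mathcal{K}_N$. For $B(\mathcal{K}\otimes\mathcal{H})$ the system is regarded as having the $N+1$ factors $\mathcal{K}_0:=\mathcal{H},\mathcal{K}_1,\dots,\mathcal{K}_N$. *)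

theory Defs
  imports "HOL-Analysis.Analysis"
begin

section \<open>Complex Hilbert spaces\<close>

text \<open>The underlying real Hilbert space structure supplies norm and topology; the compatibility
  axioms tie it to the complex one. The inner product is antilinear in its first argument.\<close>

class chilbert_space = real_inner + complete_space +
  fixes scaleC :: "complex \<Rightarrow> 'a \<Rightarrow> 'a" (infixr "*\<^sub>C" 75)
    and cinner :: "'a \<Rightarrow> 'a \<Rightarrow> complex"
  assumes scaleC_add_right: "a *\<^sub>C (x + y) = a *\<^sub>C x + a *\<^sub>C y"
    and scaleC_add_left: "(a + b) *\<^sub>C x = a *\<^sub>C x + b *\<^sub>C x"
    and scaleC_scaleC: "a *\<^sub>C b *\<^sub>C x = (a * b) *\<^sub>C x"
    and scaleR_scaleC: "r *\<^sub>R x = complex_of_real r *\<^sub>C x"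
    and cinner_commute: "cinner x y = cnj (cinner y x)"
    and cinner_add_right: "cinner x (y + z) = cinner x y + cinner x z"
    and cinner_scaleC_right: "cinner x (a *\<^sub>C y) = a * cinner x y"
    and inner_eq_Re_cinner: "inner x y = Re (cinner x y)"

global_interpretation complex_vector:
  vector_space "scaleC :: complex \<Rightarrow> 'a \<Rightarrow> 'a::chilbert_space"
  defines csubspace = complex_vector.subspace
    and cspan = complex_vector.span
proof
  fix a b :: complex and x y :: 'a
  show "a *\<^sub>C (x + y) = a *\<^sub>C x + a *\<^sub>C y" by (rule scaleC_add_right)
  show "(a + b) *\<^sub>C x = a *\<^sub>C x + b *\<^sub>C x" by (rule scaleC_add_left)
  show "a *\<^sub>C b *\<^sub>C x = (a * b) *\<^sub>C x" by (rule scaleC_scaleC)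
  show "1 *\<^sub>C x = x" using scaleR_scaleC[of 1 x] by simp
qed

definition is_onb :: "'a::chilbert_space set \<Rightarrow> bool" where
  "is_onb E \<longleftrightarrow>
     (\<forall>e\<in>E. \<forall>f\<in>E. cinner e f = (if e = f then 1 else 0)) \<and> closure (cspan E) = UNIV"

definition some_onb :: "'a::chilbert_space set" where
  "some_onb = (SOME E. is_onb E)"


section \<open>Operators\<close>

definition bounded_clinear :: "('a::chilbert_space \<Rightarrow> 'b::chilbert_space) \<Rightarrow> bool" where
  "bounded_clinear S \<longleftrightarrow> bounded_linear S \<and> (\<forall>c x. S (c *\<^sub>C x) = c *\<^sub>C S x)"

definition self_adjoint :: "('a::chilbert_space \<Rightarrow> 'a) \<Rightarrow> bool" where
  "self_adjoint S \<longleftrightarrow> (\<forall>x y. cinner (S x) y = cinner x (S y))"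

definition observable :: "('a::chilbert_space \<Rightarrow> 'a) \<Rightarrow> bool" where
  "observable S \<longleftrightarrow> bounded_clinear S \<and> self_adjoint S"

text \<open>Bounded self-adjoint operators of a Hilbert space given as a closed subspace \<open>V\<close>;
  the values of \<open>S\<close> outside \<open>V\<close> are irrelevant.\<close>

definition observable_on :: "'a::chilbert_space set \<Rightarrow> ('a \<Rightarrow> 'a) \<Rightarrow> bool" where
  "observable_on V S \<longleftrightarrow>
     (\<forall>x\<in>V. S x \<in> V) \<and>
     (\<forall>x\<in>V. \<forall>y\<in>V. S (x + y) = S x + S y) \<and>
     (\<forall>c. \<forall>x\<in>V. S (c *\<^sub>C x) = c *\<^sub>C S x) \<and>
     (\<exists>M. \<forall>x\<in>V. norm (S x) \<le> M * norm x) \<and>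
     (\<forall>x\<in>V. \<forall>y\<in>V. cinner (S x) y = cinner x (S y))"

definition cadjoint :: "('a::chilbert_space \<Rightarrow> 'b::chilbert_space) \<Rightarrow> 'b \<Rightarrow> 'a" where
  "cadjoint S = (THE R. \<forall>x y. cinner (S x) y = cinner x (R y))"

definition unitary :: "('a::chilbert_space \<Rightarrow> 'b::chilbert_space) \<Rightarrow> bool" where
  "unitary U \<longleftrightarrow> bounded_clinear U \<and> surj U \<and> (\<forall>x y. cinner (U x) (U y) = cinner x y)"

definition positive_op :: "('a::chilbert_space \<Rightarrow> 'a) \<Rightarrow> bool" where
  "positive_op S \<longleftrightarrow>
     bounded_clinear S \<and> (\<forall>x. Im (cinner x (S x)) = 0 \<and> Re (cinner x (S x)) \<ge> 0)"

definition abs_op :: "('a::chilbert_space \<Rightarrow> 'b::chilbert_space) \<Rightarrow> 'a \<Rightarrow> 'a" where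
  "abs_op S = (THE P. positive_op P \<and> P \<circ> P = cadjoint S \<circ> S)"

definition trace_class :: "('a::chilbert_space \<Rightarrow> 'a) \<Rightarrow> bool" where
  "trace_class S \<longleftrightarrow>
     bounded_clinear S \<and> (\<exists>E. is_onb E \<and> (\<lambda>e. cinner e (abs_op S e)) summable_on E)"

text \<open>For trace class operators the trace does not depend on the orthonormal basis.\<close>

definition op_trace :: "('a::chilbert_space \<Rightarrow> 'a) \<Rightarrow> complex" where
  "op_trace S = (\<Sum>\<^sub>\<infinity>e\<in>some_onb. cinner e (S e))"

definition state :: "('a::chilbert_space \<Rightarrow> 'a) \<Rightarrow> bool" where
  "state \<theta> \<longleftrightarrow> positive_op \<theta> \<and> trace_class \<theta> \<and> op_trace \<theta> = 1"

text \<open>\<open>ketbra \<phi> \<psi>\<close> is \<open>|\<phi>\<rangle>\<langle>\<psi>|\<close>.\<close>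

definition ketbra :: "'a::chilbert_space \<Rightarrow> 'b::chilbert_space \<Rightarrow> 'b \<Rightarrow> 'a" where
  "ketbra \<phi> \<psi> = (\<lambda>x. cinner \<psi> x *\<^sub>C \<phi>)"

text \<open>The traces below are real when \<open>\<theta>\<close> is a state and \<open>B\<close> an observable.\<close>

definition expected_value :: "('a::chilbert_space \<Rightarrow> 'a) \<Rightarrow> ('a \<Rightarrow> 'a) \<Rightarrow> real" where
  "expected_value \<theta> B = Re (op_trace (\<theta> \<circ> B))"

definition op_variance :: "('a::chilbert_space \<Rightarrow> 'a) \<Rightarrow> ('a \<Rightarrow> 'a) \<Rightarrow> real" where
  "op_variance \<theta> B = Re (op_trace (\<theta> \<circ> (B \<circ> B))) - (expected_value \<theta> B)\<^sup>2"


section \<open>Tensor products\<close>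

text \<open>
  A Hilbert space tensor product is a Hilbert space together with a multilinear map \<open>t\<close> from the
  product of the factors, giving the elementary tensors, whose inner products are the products of
  the inner products in the factors and which are total. This determines it up to a unique unitary
  compatible with the elementary tensors.

  The factors \<open>F i\<close> may be different Hilbert spaces; they are given as closed subspaces of one
  ambient Hilbert space, into which any family of Hilbert spaces can be embedded
  (e.g. their direct sum).
\<close>

definition hilbert_tensor ::
    "'i set \<Rightarrow> ('i \<Rightarrow> 'k::chilbert_space set) \<Rightarrow> (('i \<Rightarrow> 'k) \<Rightarrow> 'a::chilbert_space) \<Rightarrow> bool" where
  "hilbert_tensor I F t \<longleftrightarrow>
     (\<forall>i\<in>I. csubspace (F i) \<and> closed (F i)) \<and>
     (\<forall>x\<in>PiE I F. \<forall>i\<in>I. \<forall>y\<in>F i. \<forall>z\<in>F i. t (x(i := y + z)) = t (x(i := y)) + t (x(i := z))) \<and>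
     (\<forall>x\<in>PiE I F. \<forall>i\<in>I. \<forall>y\<in>F i. \<forall>c. t (x(i := c *\<^sub>C y)) = c *\<^sub>C t (x(i := y))) \<and>
     (\<forall>x\<in>PiE I F. \<forall>y\<in>PiE I F. cinner (t x) (t y) = (\<Prod>i\<in>I. cinner (x i) (y i))) \<and>
     closure (cspan (t ` PiE I F)) = UNIV"

definition hilbert_tensor2 ::
    "('a::chilbert_space \<Rightarrow> 'h::chilbert_space \<Rightarrow> 'c::chilbert_space) \<Rightarrow> bool" where
  "hilbert_tensor2 s \<longleftrightarrow>
     (\<forall>x y z. s (x + y) z = s x z + s y z) \<and>
     (\<forall>x y z. s x (y + z) = s x y + s x z) \<and>
     (\<forall>c x y. s (c *\<^sub>C x) y = c *\<^sub>C s x y \<and> s x (c *\<^sub>C y) = c *\<^sub>C s x y) \<and>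
     (\<forall>x y x' y'. cinner (s x y) (s x' y') = cinner x x' * cinner y y') \<and>
     closure (cspan (range (\<lambda>(x, y). s x y))) = UNIV"

text \<open>The tensor product of two bounded operators, relative to the elementary tensors \<open>s\<close>.\<close>

definition op_tensor ::
    "('a::chilbert_space \<Rightarrow> 'h::chilbert_space \<Rightarrow> 'c::chilbert_space)
      \<Rightarrow> ('a \<Rightarrow> 'a) \<Rightarrow> ('h \<Rightarrow> 'h) \<Rightarrow> 'c \<Rightarrow> 'c" where
  "op_tensor s S R = (THE X. bounded_clinear X \<and> (\<forall>x y. X (s x y) = s (S x) (R y)))"


section \<open>Microscopic and macroscopic observables\<close>

text \<open>\<open>X = 1 \<otimes> \<dots> \<otimes> 1 \<otimes> X\<^sub>i \<otimes> 1 \<otimes> \<dots> \<otimes> 1\<close> with \<open>X\<^sub>i\<close> a bounded self-adjoint operator on \<open>F i\<close>.\<close>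

definition acts_on_factor ::
    "'i set \<Rightarrow> ('i \<Rightarrow> 'k::chilbert_space set) \<Rightarrow> (('i \<Rightarrow> 'k) \<Rightarrow> 'a::chilbert_space)
      \<Rightarrow> 'i \<Rightarrow> ('a \<Rightarrow> 'a) \<Rightarrow> bool" where
  "acts_on_factor I F t i X \<longleftrightarrow>
     bounded_clinear X \<and>
     (\<exists>X\<^sub>i. observable_on (F i) X\<^sub>i \<and> (\<forall>x\<in>PiE I F. X (t x) = t (x(i := X\<^sub>i (x i)))))"

text \<open>The same for \<open>\<K> \<otimes> \<H>\<close>, where \<open>\<K>\<close> is the tensor product of the factors
  \<open>F 1, \<dots>, F N\<close>, regarded as a system with the \<open>N + 1\<close> factors \<open>\<H>, F 1, \<dots>, F N\<close>
  numbered \<open>0, \<dots>, N\<close>.\<close>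

definition acts_on_factor_ext ::
    "nat \<Rightarrow> (nat \<Rightarrow> 'k::chilbert_space set) \<Rightarrow> ((nat \<Rightarrow> 'k) \<Rightarrow> 'a::chilbert_space)
      \<Rightarrow> ('a \<Rightarrow> 'h::chilbert_space \<Rightarrow> 'c::chilbert_space) \<Rightarrow> nat \<Rightarrow> ('c \<Rightarrow> 'c) \<Rightarrow> bool" where
  "acts_on_factor_ext N F t s i X \<longleftrightarrow>
     (if i = 0 then \<exists>X\<^sub>0. observable X\<^sub>0 \<and> X = op_tensor s id X\<^sub>0
      else \<exists>Z. acts_on_factor {1..N} F t i Z \<and> X = op_tensor s Z id)"

text \<open>In the following two definitions \<open>L i X\<close> says that \<open>X\<close> is an observable acting on factor
  \<open>i\<close> only. Operators on a factor are identified with their ampliations, which have the same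
  norm.\<close>

definition microscopic ::
    "'i set \<Rightarrow> ('i \<Rightarrow> ('a::chilbert_space \<Rightarrow> 'a) \<Rightarrow> bool) \<Rightarrow> ('a \<Rightarrow> 'a) \<Rightarrow> bool" where
  "microscopic I L X \<longleftrightarrow> (\<exists>i\<in>I. L i X)"

definition macroscopic ::
    "'i set \<Rightarrow> ('i \<Rightarrow> ('a::chilbert_space \<Rightarrow> 'a) \<Rightarrow> bool) \<Rightarrow> ('a \<Rightarrow> 'a) \<Rightarrow> bool" where
  "macroscopic I L Y \<longleftrightarrow>
     (\<exists>Z. (\<forall>i\<in>I. L i (Z i) \<and> onorm (Z i) \<le> onorm Y) \<and>
          Y = (\<lambda>v. (1 / real (card I)) *\<^sub>R (\<Sum>i\<in>I. Z i v)))"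


section \<open>The state transformation\<close>

definition evolution ::
    "('a::chilbert_space \<Rightarrow> 'h::chilbert_space \<Rightarrow> 'c::chilbert_space)
      \<Rightarrow> ('c \<Rightarrow> 'c) \<Rightarrow> ('a \<Rightarrow> 'a) \<Rightarrow> ('h \<Rightarrow> 'h) \<Rightarrow> 'c \<Rightarrow> 'c" where
  "evolution s U \<tau> \<rho> = U \<circ> op_tensor s \<tau> \<rho> \<circ> cadjoint U"

end

theory Submission imports Defs
begin

text \<open>
  A positive operator of finite trace is \<open>\<tau> = \<Sum>\<^sub>k |g\<^sub>k\<rangle>\<langle>g\<^sub>k|\<close> with \<open>\<Sum>\<^sub>k \<parallel>g\<^sub>k\<parallel>\<^sup>2 = tr \<tau>\<close> (a Cholesky
  decomposition, no spectral theorem needed), so that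
  \<open>tr (T(|\<psi>\<rangle>\<langle>\<psi>|) X) = \<Sum>\<^sub>k \<langle>u\<^sub>k, X u\<^sub>k\<rangle>\<close> with \<open>u\<^sub>k = U (g\<^sub>k \<otimes> \<psi>)\<close>. Let \<open>u\<^sub>k\<close> and \<open>v\<^sub>k\<close> belong to
  \<open>\<psi>\<^sub>0\<close> and \<open>\<psi>\<^sub>1\<close>. The two traces in the theorem differ by cross terms
  \<open>\<Sum>\<^sub>k \<langle>v\<^sub>k, A u\<^sub>k\<rangle>\<close> and \<open>\<Sum>\<^sub>k \<langle>u\<^sub>k, A v\<^sub>k\<rangle>\<close>, whose coefficients have modulus
  \<open>|\<alpha>\<^sub>0 \<alpha>\<^sub>1| \<le> 1/2\<close>. Since
  \<open>(b\<^sub>0 - b\<^sub>1) \<langle>v, A u\<rangle> = \<langle>v, [A, B] u\<rangle> - \<langle>v, A (B - b\<^sub>0) u\<rangle> + \<langle>(B - b\<^sub>1) v, A u\<rangle>\<close>, the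
  Cauchy--Schwarz inequality bounds each of them by
  \<open>(\<parallel>[A, B]\<parallel> + (\<sigma>\<^sub>0 + \<sigma>\<^sub>1) \<parallel>A\<parallel>) / |b\<^sub>0 - b\<^sub>1|\<close>. Finally \<open>\<parallel>[A, B]\<parallel> \<le> (2/N) \<parallel>A\<parallel> \<parallel>B\<parallel>\<close>, because a
  microscopic observable commutes with all but one of the summands of \<open>B\<close>, and a macroscopic one
  is an average of microscopic ones.
\<close>

section \<open>Complex inner product spaces and bounded operators\<close>

lemma cinner_add_left: "cinner (x + y) z = cinner x z + cinner y z"
  for x y z :: "'a::chilbert_space"
  by (metis cinner_add_right cinner_commute complex_cnj_add)

lemma cinner_scaleC_left: "cinner (c *\<^sub>C x) y = cnj c * cinner x y"
  for x y :: "'a::chilbert_space"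
  by (metis cinner_commute cinner_scaleC_right complex_cnj_mult)

lemma cinner_zero_right [simp]: "cinner (x::'a::chilbert_space) 0 = 0"
  using cinner_add_right[of x 0 0] by simp

lemma cinner_zero_left [simp]: "cinner 0 (x::'a::chilbert_space) = 0"
  using cinner_add_left[of 0 0 x] by simp

lemma cinner_minus_right: "cinner (x::'a::chilbert_space) (- y) = - cinner x y"
  using cinner_add_right[of x y "- y"] by (simp add: add_eq_0_iff)

lemma cinner_minus_left: "cinner (- x) (y::'a::chilbert_space) = - cinner x y"
  using cinner_add_left[of x "- x" y] by (simp add: add_eq_0_iff)

lemma cinner_diff_right: "cinner (x::'a::chilbert_space) (y - z) = cinner x y - cinner x z"
  using cinner_add_right[of x y "- z"] by (simp add: cinner_minus_right)

lemma cinner_diff_left: "cinner (x - y) (z::'a::chilbert_space) = cinner x z - cinner y z"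
  using cinner_add_left[of x "- y" z] by (simp add: cinner_minus_left)

lemma cinner_scaleR_right: "cinner (x::'a::chilbert_space) (r *\<^sub>R y) = complex_of_real r * cinner x y"
  by (simp add: scaleR_scaleC cinner_scaleC_right)

lemma cinner_scaleR_left: "cinner (r *\<^sub>R x) (y::'a::chilbert_space) = complex_of_real r * cinner x y"
  by (simp add: scaleR_scaleC cinner_scaleC_left)

lemma cinner_sum_right: "cinner (x::'a::chilbert_space) (\<Sum>i\<in>I. f i) = (\<Sum>i\<in>I. cinner x (f i))"
  by (induction I rule: infinite_finite_induct) (auto simp: cinner_add_right)

lemma cinner_sum_left: "cinner (\<Sum>i\<in>I. f i) (x::'a::chilbert_space) = (\<Sum>i\<in>I. cinner (f i) x)"
  by (induction I rule: infinite_finite_induct) (auto simp: cinner_add_left)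

lemmas cinner_simps = cinner_add_left cinner_add_right cinner_diff_left cinner_diff_right
  cinner_minus_left cinner_minus_right cinner_scaleC_left cinner_scaleC_right
  cinner_scaleR_left cinner_scaleR_right cinner_sum_left cinner_sum_right

lemma cinner_self: "cinner x x = complex_of_real ((norm x)\<^sup>2)" for x :: "'a::chilbert_space"
proof -
  have "cinner x x \<in> \<real>" using cinner_commute[of x x] Reals_cnj_iff by metis
  then have "cinner x x = complex_of_real (Re (cinner x x))" by simp
  then show ?thesis by (simp add: inner_eq_Re_cinner[symmetric] power2_norm_eq_inner)
qed

lemma norm_scaleC: "norm (c *\<^sub>C x) = cmod c * norm x" for x :: "'a::chilbert_space"
proof -
  have "complex_of_real ((norm (c *\<^sub>C x))\<^sup>2) = cnj c * c * complex_of_real ((norm x)\<^sup>2)"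
    by (simp only: cinner_self[symmetric] cinner_scaleC_left cinner_scaleC_right mult_ac)
  also have "cnj c * c = complex_of_real ((cmod c)\<^sup>2)"
    by (metis complex_norm_square mult.commute)
  finally have "(norm (c *\<^sub>C x))\<^sup>2 = (cmod c * norm x)\<^sup>2"
    unfolding of_real_mult[symmetric] of_real_eq_iff by (simp add: power_mult_distrib)
  then show ?thesis by (simp add: power2_eq_iff_nonneg)
qed

lemma scaleC_scaleR: "c *\<^sub>C r *\<^sub>R x = r *\<^sub>R c *\<^sub>C x" for x :: "'a::chilbert_space"
  by (simp add: scaleR_scaleC scaleC_scaleC mult.commute)

lemma complex_phase: "\<exists>c. cmod c = 1 \<and> c * z = complex_of_real (cmod z)"
proof (cases "z = 0")
  case False
  then show ?thesis
    by (intro exI[of _ "cnj z / complex_of_real (cmod z)"])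
       (simp add: norm_divide complex_norm_square[symmetric] power2_eq_square field_simps)
qed (auto intro: exI[of _ 1])

lemma cinner_cauchy_schwarz: "cmod (cinner x y) \<le> norm x * norm y" for x y :: "'a::chilbert_space"
proof -
  \<comment> \<open>The phase \<open>c\<close> turns the complex inner product onto the nonnegative
    real axis, where the Cauchy-Schwarz inequality of the underlying real inner product
    applies.\<close>
  obtain c where c: "cmod c = 1" "c * cinner x y = complex_of_real (cmod (cinner x y))"
    using complex_phase by blast
  have "cmod (cinner x y) = inner x (c *\<^sub>C y)"
    by (simp add: inner_eq_Re_cinner cinner_scaleC_right c(2))
  also have "\<dots> \<le> norm x * norm (c *\<^sub>C y)" by (rule norm_cauchy_schwarz)
  finally show ?thesis by (simp add: norm_scaleC c(1))
qed

lemma bounded_bilinear_cinner: "bounded_bilinear (cinner :: 'a::chilbert_space \<Rightarrow> 'a \<Rightarrow> complex)"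
  by unfold_locales
     (auto simp: cinner_simps scaleR_conv_of_real intro!: exI[of _ 1] cinner_cauchy_schwarz)

section \<open>Bounded complex-linear operators\<close>

lemma bounded_clinear_imp_bounded_linear: "bounded_clinear S \<Longrightarrow> bounded_linear S"
  by (simp add: bounded_clinear_def)

lemma bounded_clinearI:
  fixes S :: "'a::chilbert_space \<Rightarrow> 'b::chilbert_space"
  assumes "\<And>x y. S (x + y) = S x + S y" "\<And>c x. S (c *\<^sub>C x) = c *\<^sub>C S x"
    and "\<And>x. norm (S x) \<le> M * norm x"
  shows "bounded_clinear S"
  unfolding bounded_clinear_def
proof (intro conjI allI assms(2) bounded_linear_intro[where K = M])
  show "S (r *\<^sub>R x) = r *\<^sub>R S x" for r x by (simp add: scaleR_scaleC assms(2))
  show "norm (S x) \<le> norm x * M" for x using assms(3)[of x] by (simp add: mult.commute)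
qed (fact assms(1))

lemma bounded_clinear_simps:
  assumes "bounded_clinear S"
  shows "S (x + y) = S x + S y" "S (x - y) = S x - S y" "S (- x) = - S x" "S 0 = 0"
    "S (c *\<^sub>C x) = c *\<^sub>C S x" "S (r *\<^sub>R x) = r *\<^sub>R S x" "S (sum f I) = (\<Sum>i\<in>I. S (f i))"
    "norm (S x) \<le> onorm S * norm x"
proof -
  interpret bounded_linear S using assms by (rule bounded_clinear_imp_bounded_linear)
  show "S (x + y) = S x + S y" "S (x - y) = S x - S y" "S (- x) = - S x" "S 0 = 0"
    "S (r *\<^sub>R x) = r *\<^sub>R S x" "S (sum f I) = (\<Sum>i\<in>I. S (f i))"
    by (auto simp: add diff neg zero scaleR sum)
  show "S (c *\<^sub>C x) = c *\<^sub>C S x" using assms by (simp add: bounded_clinear_def)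
  show "norm (S x) \<le> onorm S * norm x" by (rule onorm) (rule bounded_linear_axioms)
qed

lemma bounded_clinear_compose:
  assumes "bounded_clinear S" "bounded_clinear R"
  shows "bounded_clinear (\<lambda>x. S (R x))"
  using assms bounded_linear_compose[of S R] by (auto simp: bounded_clinear_def)

lemma bounded_clinear_ident: "bounded_clinear (\<lambda>x. x)"
  by (auto simp: bounded_clinear_def)

lemma bounded_clinear_add:
  assumes "bounded_clinear S" "bounded_clinear R"
  shows "bounded_clinear (\<lambda>x. S x + R x)"
  using assms bounded_linear_add[of S R] by (auto simp: bounded_clinear_def scaleC_add_right)

lemma bounded_clinear_diff:
  assumes "bounded_clinear S" "bounded_clinear R"
  shows "bounded_clinear (\<lambda>x. S x - R x)"
  using assms bounded_linear_sub[of S R]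
  by (auto simp: bounded_clinear_def complex_vector.scale_right_diff_distrib)

lemma bounded_clinear_scaleC: "bounded_clinear (\<lambda>x. c *\<^sub>C x)"
  by (rule bounded_clinearI[where M = "cmod c"])
     (auto simp: scaleC_add_right scaleC_scaleC mult.commute norm_scaleC)

lemma bounded_clinear_sum:
  assumes "\<And>i. i \<in> I \<Longrightarrow> bounded_clinear (S i)"
  shows "bounded_clinear (\<lambda>x. \<Sum>i\<in>I. S i x)"
  using assms bounded_linear_sum[of I S]
  by (auto simp: bounded_clinear_def complex_vector.scale_sum_right intro!: sum.cong)

lemma bounded_clinear_scaleR:
  assumes "bounded_clinear S"
  shows "bounded_clinear (\<lambda>x. r *\<^sub>R S x)"
  using assms bounded_linear_scaleR_right[THEN bounded_linear_compose, of S r]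
  by (auto simp: bounded_clinear_def scaleC_scaleR)

lemma bounded_clinear_ketbra: "bounded_clinear (ketbra \<phi> \<psi>)"
proof (rule bounded_clinearI[where M = "norm \<phi> * norm \<psi>"])
  show "norm (ketbra \<phi> \<psi> x) \<le> norm \<phi> * norm \<psi> * norm x" for x
    using mult_right_mono[OF cinner_cauchy_schwarz[of \<psi> x] norm_ge_zero[of \<phi>]]
    by (simp add: ketbra_def norm_scaleC mult_ac)
qed (simp_all add: ketbra_def cinner_simps scaleC_add_left scaleC_scaleC)

section \<open>Closed subspaces and density arguments\<close>

lemma csubspace_closure:
  fixes V :: "'a::chilbert_space set"
  assumes "csubspace V"
  shows "csubspace (closure V)"
proof (rule complex_vector.subspaceI)
  show "0 \<in> closure V" using complex_vector.subspace_0[OF assms] closure_subset by blast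
next
  fix x y assume "x \<in> closure V" "y \<in> closure V"
  then obtain f g where fg: "\<And>n. f n \<in> V" "f \<longlonglongrightarrow> x" "\<And>n. g n \<in> V" "g \<longlonglongrightarrow> y"
    unfolding closure_sequential by metis
  have "(\<lambda>n::nat. f n + g n) \<longlonglongrightarrow> x + y" using fg by (intro tendsto_add)
  moreover have "f n + g n \<in> V" for n using fg complex_vector.subspace_add[OF assms] by blast
  ultimately show "x + y \<in> closure V" unfolding closure_sequential by (intro exI[of _ "\<lambda>n. f n + g n"]) auto
next
  fix c and x :: 'a assume "x \<in> closure V"
  then obtain f where f: "\<And>n. f n \<in> V" "f \<longlonglongrightarrow> x" unfolding closure_sequential by metis
  have "(\<lambda>n::nat. c *\<^sub>C f n) \<longlonglongrightarrow> c *\<^sub>C x"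
    by (rule bounded_linear.tendsto[OF
          bounded_clinear_imp_bounded_linear[OF bounded_clinear_scaleC] f(2)])
  moreover have "c *\<^sub>C f n \<in> V" for n using f complex_vector.subspace_scale[OF assms] by blast
  ultimately show "c *\<^sub>C x \<in> closure V"
    unfolding closure_sequential by (intro exI[of _ "\<lambda>n. c *\<^sub>C f n"]) auto
qed

text \<open>The vectors on which the two operators agree form a closed complex subspace. This is
  what lets values on elementary tensors determine an operator.\<close>

lemma eq_on_dense:
  assumes "bounded_clinear S" "bounded_clinear R" "closure (cspan G) = UNIV"
    and "\<And>x. x \<in> G \<Longrightarrow> S x = R x"
  shows "S = R"
proof -
  let ?D = "{x. S x - R x = 0}"
  have D: "bounded_clinear (\<lambda>x. S x - R x)" using assms by (intro bounded_clinear_diff)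
  have "csubspace ?D"
    by (rule complex_vector.subspaceI) (auto simp: bounded_clinear_simps[OF assms(1)] bounded_clinear_simps[OF assms(2)])
  then have "cspan G \<subseteq> ?D" using assms(4) by (intro complex_vector.span_minimal) auto
  moreover have "closed ?D"
    by (rule continuous_closed_preimage_constant[of UNIV, simplified])
       (intro linear_continuous_on bounded_clinear_imp_bounded_linear D)
  ultimately have "closure (cspan G) \<subseteq> ?D" by (intro closure_minimal)
  then show ?thesis using assms(3) by auto
qed

text \<open>The vectors orthogonal to \<open>z\<close> form a closed subspace containing
  \<open>G\<close>, so \<open>z\<close> is orthogonal to itself.\<close>

lemma orthogonal_dense_imp_zero:
  fixes z :: "'a::chilbert_space"
  assumes "closure (cspan G) = UNIV" "\<And>v. v \<in> G \<Longrightarrow> cinner v z = 0"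
  shows "z = 0"
proof -
  let ?D = "{x. cinner x z = 0}"
  have "csubspace ?D" by (rule complex_vector.subspaceI) (auto simp: cinner_simps)
  then have "cspan G \<subseteq> ?D" using assms(2) by (intro complex_vector.span_minimal) auto
  moreover have "closed ?D"
    by (rule continuous_closed_preimage_constant[of UNIV, simplified])
       (intro linear_continuous_on bounded_bilinear.bounded_linear_left[OF bounded_bilinear_cinner])
  ultimately have "closure (cspan G) \<subseteq> ?D" by (intro closure_minimal)
  then have "cinner z z = 0" using assms(1) by auto
  then show ?thesis by (simp add: cinner_self)
qed

lemma cinner_ext: "(\<And>x. cinner x y = cinner x z) \<Longrightarrow> y = z" for y z :: "'a::chilbert_space"
proof -
  assume "\<And>x. cinner x y = cinner x z"
  then have "cinner (y - z) (y - z) = 0" by (simp add: cinner_diff_right)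
  then show ?thesis by (simp add: cinner_self)
qed

section \<open>Projection, Riesz representation, adjoints\<close>

text \<open>The core of the projection theorem: the difference between a point outside
  \<open>V\<close> and its nearest point in \<open>V\<close> is orthogonal to
  \<open>V\<close>.\<close>

lemma exists_orthogonal:
  fixes V :: "'a::chilbert_space set"
  assumes V: "csubspace V" "closed V" and "V \<noteq> UNIV"
  shows "\<exists>z. z \<noteq> 0 \<and> (\<forall>v\<in>V. cinner v z = 0)"
proof -
  obtain x where x: "x \<notin> V" using assms(3) by auto
  have V0: "0 \<in> V" using V(1) by (rule complex_vector.subspace_0)
  define d where "d = infdist x V"
  have d_le: "d \<le> norm (x - v)" if "v \<in> V" for v
    using infdist_le[OF that, of x] by (simp add: d_def dist_norm)
  have d0: "d \<ge> 0" unfolding d_def by (rule infdist_nonneg)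
  have "\<exists>v\<in>V. norm (x - v) < d + 1 / real (Suc n)" for n
  proof -
    have "(INF v\<in>V. dist x v) < d + 1 / real (Suc n)"
      using V0 by (auto simp: d_def infdist_def)
    moreover have "V \<noteq> {}" "bdd_below (dist x ` V)" using V0 by (auto intro!: bdd_belowI2[of _ 0])
    ultimately show ?thesis by (simp add: cINF_less_iff dist_norm)
  qed
  then obtain v where v: "\<And>n. v n \<in> V" "\<And>n. norm (x - v n) < d + 1 / real (Suc n)" by metis
  \<comment> \<open>Parallelogram law: the midpoint of \<open>a\<close> and \<open>b\<close> lies in
    \<open>V\<close>, hence at distance at least \<open>d\<close> from \<open>x\<close>, so
    near-minimisers are close to each other. This makes the minimising sequence \<open>v\<close>
    Cauchy.\<close>
  have par: "(norm (a - b))\<^sup>2 \<le> 2 * (norm (x - a))\<^sup>2 + 2 * (norm (x - b))\<^sup>2 - 4 * d\<^sup>2"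
    if "a \<in> V" "b \<in> V" for a b
  proof -
    have "(1/2) *\<^sub>R (a + b) \<in> V"
      unfolding scaleR_scaleC
      using V(1) that complex_vector.subspace_add complex_vector.subspace_scale by blast
    then have "d\<^sup>2 \<le> (norm (x - (1/2) *\<^sub>R (a + b)))\<^sup>2" using d_le d0 power_mono by blast
    moreover have "(norm (a - b))\<^sup>2 + 4 * (norm (x - (1/2) *\<^sub>R (a + b)))\<^sup>2
        = 2 * (norm (x - a))\<^sup>2 + 2 * (norm (x - b))\<^sup>2"
      by (simp add: power2_norm_eq_inner inner_commute algebra_simps)
    ultimately show ?thesis by linarith
  qed
  have lim: "(\<lambda>n. norm (x - v n)) \<longlonglongrightarrow> d"
  proof (rule tendsto_sandwich[where f = "\<lambda>n. d" and h = "\<lambda>n. d + 1 / real (Suc n)"])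
    show "(\<lambda>n. d + 1 / real (Suc n)) \<longlonglongrightarrow> d"
      using tendsto_add[OF tendsto_const[of d] LIMSEQ_inverse_real_of_nat] by (simp add: field_simps)
    show "(\<lambda>n. d) \<longlonglongrightarrow> d" by simp
    show "\<forall>\<^sub>F n in sequentially. norm (x - v n) \<le> d + 1 / real (Suc n)"
      using v(2) by (intro always_eventually allI less_imp_le)
  qed (use d_le v(1) in auto)
  have "Cauchy v"
  proof (rule metric_CauchyI)
    fix e :: real assume "e > 0"
    have "(\<lambda>n. (norm (x - v n))\<^sup>2) \<longlonglongrightarrow> d\<^sup>2" using lim by (intro tendsto_power)
    then have "\<forall>\<^sub>F n in sequentially. (norm (x - v n))\<^sup>2 < d\<^sup>2 + e\<^sup>2 / 4"
      using \<open>e > 0\<close> by (intro order_tendstoD(2)) auto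
    then obtain M where M: "\<And>n. n \<ge> M \<Longrightarrow> (norm (x - v n))\<^sup>2 < d\<^sup>2 + e\<^sup>2 / 4"
      unfolding eventually_sequentially by blast
    have "dist (v m) (v n) < e" if "m \<ge> M" "n \<ge> M" for m n
    proof -
      have "(norm (v m - v n))\<^sup>2 < e\<^sup>2"
        using par[OF v(1)[of m] v(1)[of n]] M[OF that(1)] M[OF that(2)] by linarith
      then show ?thesis using \<open>e > 0\<close> by (simp add: dist_norm power2_less_imp_less)
    qed
    then show "\<exists>M. \<forall>m\<ge>M. \<forall>n\<ge>M. dist (v m) (v n) < e" by blast
  qed
  then obtain p where p: "v \<longlonglongrightarrow> p" using Cauchy_convergent convergent_def by blast
  have "p \<in> V" using closed_sequentially[OF V(2) _ p] v(1) by blast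
  have np: "norm (x - p) = d"
    using LIMSEQ_unique[OF tendsto_norm[OF tendsto_diff[OF tendsto_const p]] lim] .
  define z where "z = x - p"
  have "z \<noteq> 0" using x \<open>p \<in> V\<close> by (auto simp: z_def)
  have re: "inner z w = 0" if "w \<in> V" for w
  proof (rule ccontr)
    assume nz: "inner z w \<noteq> 0"
    then have w: "inner w w > 0" by auto
    \<comment> \<open>This value minimises the norm of \<open>z - r *\<^sub>R w\<close>, so a
      nonzero \<open>inner z w\<close> would give a point of \<open>V\<close> closer to
      \<open>x\<close> than \<open>p\<close>.\<close>
    define r where "r = inner z w / inner w w"
    have "p + r *\<^sub>R w \<in> V"
      unfolding scaleR_scaleC
      using V(1) that \<open>p \<in> V\<close> complex_vector.subspace_add complex_vector.subspace_scale by blast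
    then have "(norm z)\<^sup>2 \<le> (norm (x - (p + r *\<^sub>R w)))\<^sup>2"
      using d_le[of "p + r *\<^sub>R w"] np d0 by (intro power_mono) (auto simp: z_def)
    also have "x - (p + r *\<^sub>R w) = z - r *\<^sub>R w" by (simp add: z_def)
    also have "(norm (z - r *\<^sub>R w))\<^sup>2 = (norm z)\<^sup>2 - 2 * r * inner z w + r * r * inner w w"
      by (simp add: power2_norm_eq_inner inner_commute algebra_simps)
    also have "\<dots> = (norm z)\<^sup>2 - (inner z w)\<^sup>2 / inner w w"
      using w by (simp add: r_def power2_eq_square field_simps)
    finally have "(inner z w)\<^sup>2 / inner w w \<le> 0" by simp
    moreover have "(inner z w)\<^sup>2 / inner w w > 0" using nz w by simp
    ultimately show False by simp
  qed
  have "cinner w z = 0" if "w \<in> V" for w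
  proof -
    \<comment> \<open>\<open>re\<close> controls only the real part of \<open>cinner z w\<close>;
      applied to \<open>\<i> *\<^sub>C w\<close> it gives the imaginary part.\<close>
    have "\<i> *\<^sub>C w \<in> V" using V(1) that by (rule complex_vector.subspace_scale)
    then have "Re (cinner z w) = 0" "Re (cinner z (\<i> *\<^sub>C w)) = 0"
      using re that by (auto simp: inner_eq_Re_cinner)
    then have "cinner z w = 0" by (simp add: cinner_scaleC_right complex_eq_iff)
    then show ?thesis by (subst cinner_commute) simp
  qed
  with \<open>z \<noteq> 0\<close> show ?thesis by blast
qed

text \<open>Take \<open>z\<close> orthogonal to the kernel of \<open>f\<close>. The combination
  \<open>f x *\<^sub>C z - f z *\<^sub>C x\<close> lies in the kernel, and pairing it with
  \<open>z\<close> expresses \<open>f x\<close> through \<open>cinner z x\<close>.\<close>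

lemma riesz_representation:
  fixes f :: "'a::chilbert_space \<Rightarrow> complex"
  assumes f: "bounded_linear f" and fc: "\<And>c x. f (c *\<^sub>C x) = c * f x"
  shows "\<exists>z. \<forall>x. f x = cinner z x"
proof -
  interpret bounded_linear f by (rule f)
  let ?V = "{x. f x = 0}"
  have V: "csubspace ?V" by (rule complex_vector.subspaceI) (auto simp: add fc zero)
  have cl: "closed ?V"
    by (rule continuous_closed_preimage_constant[of UNIV, simplified])
       (intro linear_continuous_on f)
  show ?thesis
  proof (cases "?V = UNIV")
    case True
    then show ?thesis by (intro exI[of _ 0]) auto
  next
    case False
    obtain z where z: "z \<noteq> 0" "\<And>v. f v = 0 \<Longrightarrow> cinner v z = 0"
      using exists_orthogonal[OF V cl False] by blast
    have orth: "f x * cinner z z = f z * cinner z x" for x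
    proof -
      have "f (f x *\<^sub>C z - f z *\<^sub>C x) = 0" by (simp add: diff fc)
      from z(2)[OF this] have "cinner z (f x *\<^sub>C z - f z *\<^sub>C x) = 0"
        by (subst cinner_commute) simp
      then show ?thesis by (simp add: cinner_simps)
    qed
    have nz: "cinner z z \<noteq> 0" using z(1) by (simp add: cinner_self)
    have "f x = cinner (cnj (f z / cinner z z) *\<^sub>C z) x" for x
      using orth[of x] nz by (simp add: cinner_simps field_simps)
    then show ?thesis by blast
  qed
qed

text \<open>The Riesz representation of \<open>\<lambda>x. cinner y (S x)\<close> supplies the
  vector \<open>R y\<close>; its norm bound comes from Cauchy-Schwarz for
  \<open>cinner (S (R y)) y\<close>.\<close>

lemma adjoint_exists:
  fixes S :: "'a::chilbert_space \<Rightarrow> 'b::chilbert_space"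
  assumes S: "bounded_clinear S"
  shows "\<exists>R. bounded_clinear R \<and> (\<forall>x y. cinner (S x) y = cinner x (R y))
    \<and> (\<forall>y. norm (R y) \<le> onorm S * norm y)"
proof -
  have "\<exists>z. \<forall>x. cinner y (S x) = cinner z x" for y
  proof (rule riesz_representation)
    show "bounded_linear (\<lambda>x. cinner y (S x))"
      using bounded_bilinear.bounded_linear_right[OF bounded_bilinear_cinner]
        bounded_clinear_imp_bounded_linear[OF S] by (rule bounded_linear_compose)
  qed (simp add: bounded_clinear_simps[OF S] cinner_simps)
  then obtain R where R: "\<And>x y. cinner y (S x) = cinner (R y) x" by metis
  have R': "cinner (S x) y = cinner x (R y)" for x y
    using R[of y x] by (metis cinner_commute)
  have nR: "norm (R y) \<le> onorm S * norm y" for y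
  proof (cases "R y = 0")
    case True
    then show ?thesis
      using onorm_pos_le[OF bounded_clinear_imp_bounded_linear[OF S]] by simp
  next
    case False
    have "(norm (R y))\<^sup>2 = cmod (cinner (S (R y)) y)" by (simp add: R' cinner_self norm_power)
    also have "\<dots> \<le> norm (S (R y)) * norm y" by (rule cinner_cauchy_schwarz)
    also have "\<dots> \<le> onorm S * norm (R y) * norm y"
      by (intro mult_right_mono bounded_clinear_simps(8)[OF S]) auto
    finally show ?thesis using False by (simp add: power2_eq_square)
  qed
  have "bounded_clinear R"
  proof (rule bounded_clinearI[OF _ _ nR])
    show "R (x + y) = R x + R y" for x y
      by (rule cinner_ext) (simp add: cinner_simps R'[symmetric])
    show "R (c *\<^sub>C x) = c *\<^sub>C R x" for c x
      by (rule cinner_ext) (simp add: cinner_simps R'[symmetric])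
  qed
  with R' nR show ?thesis by blast
qed

text \<open>With \<open>R\<close> the adjoint and \<open>y\<close> in \<open>G\<close>, the vector
  \<open>S y - R y\<close> is orthogonal to the total set \<open>G\<close> and hence zero; then
  \<open>S = R\<close> by density.\<close>

lemma self_adjoint_on_dense:
  assumes S: "bounded_clinear S" and G: "closure (cspan G) = UNIV"
    and "\<And>x y. x \<in> G \<Longrightarrow> y \<in> G \<Longrightarrow> cinner (S x) y = cinner x (S y)"
  shows "self_adjoint S"
proof -
  obtain R where R: "bounded_clinear R" "\<And>x y. cinner (S x) y = cinner x (R y)"
    using adjoint_exists[OF S] by blast
  have "S y = R y" if "y \<in> G" for y
  proof -
    have "S y - R y = 0"
      by (rule orthogonal_dense_imp_zero[OF G]) (simp add: cinner_diff_right assms(3)[symmetric] that R(2))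
    then show ?thesis by simp
  qed
  then have "S = R" by (rule eq_on_dense[OF S R(1) G])
  then show ?thesis using R(2) by (simp add: self_adjoint_def)
qed

section \<open>Orthonormal bases and traces\<close>

text \<open>Zorn's lemma gives a maximal orthonormal set; if its span were not dense, a unit vector
  orthogonal to the closed span could be adjoined.\<close>

lemma onb_exists: "\<exists>E :: 'a::chilbert_space set. is_onb E"
proof -
  define on where "on E \<longleftrightarrow> (\<forall>e\<in>E. \<forall>f\<in>E. cinner e f = (if e = f then 1 else 0))"
    for E :: "'a set"
  have "\<exists>M\<in>{E. on E}. \<forall>X\<in>{E. on E}. M \<subseteq> X \<longrightarrow> X = M"
  proof (rule subset_Zorn')
    fix C :: "'a set set" assume C: "subset.chain {E. on E} C"
    \<comment> \<open>Orthonormality is a condition on pairs, and any two elements of the union of a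
      chain already lie in one member.\<close>
    have "\<exists>X\<in>C. e \<in> X \<and> f \<in> X" if ef: "e \<in> \<Union>C" "f \<in> \<Union>C" for e f
    proof -
      obtain X Y where "X \<in> C" "Y \<in> C" "e \<in> X" "f \<in> Y" using ef by blast
      moreover have "X \<subseteq> Y \<or> Y \<subseteq> X" using C \<open>X \<in> C\<close> \<open>Y \<in> C\<close> unfolding subset_chain_def by blast
      ultimately show ?thesis by blast
    qed
    moreover have "on X" if "X \<in> C" for X using C that unfolding subset_chain_def by blast
    ultimately show "\<Union>C \<in> {E. on E}" unfolding on_def mem_Collect_eq by metis
  qed
  then obtain E where E: "on E" and max: "\<And>X. on X \<Longrightarrow> E \<subseteq> X \<Longrightarrow> X = E" by auto
  have "closure (cspan E) = UNIV"
  proof (rule ccontr)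
    assume "closure (cspan E) \<noteq> UNIV"
    then obtain z where z: "z \<noteq> 0" "\<And>v. v \<in> closure (cspan E) \<Longrightarrow> cinner v z = 0"
      using exists_orthogonal[OF csubspace_closure[OF complex_vector.subspace_span] closed_closure]
      by blast
    have ez: "cinner e z = 0" if "e \<in> E" for e
      using z(2) that closure_subset complex_vector.span_base by blast
    define u where "u = (1 / norm z) *\<^sub>R z"
    have u: "cinner u u = 1" "\<And>e. e \<in> E \<Longrightarrow> cinner e u = 0" "\<And>e. e \<in> E \<Longrightarrow> cinner u e = 0"
      using z(1) ez by (auto simp: u_def cinner_simps cinner_self power2_eq_square)
        (metis cinner_commute complex_cnj_zero ez)
    have "on (insert u E)" using E u unfolding on_def by auto
    then have "u \<in> E" using max by blast
    then show False using u(1,2) by force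
  qed
  then show ?thesis using E unfolding is_onb_def on_def by blast
qed

lemma some_onb_is_onb: "is_onb (some_onb :: 'a::chilbert_space set)"
  unfolding some_onb_def using onb_exists by (rule someI_ex)

text \<open>Bessel's inequality: orthonormality gives \<open>cinner ?p ?p = cinner ?p x\<close>, and
  Cauchy-Schwarz finishes.\<close>

lemma norm_projection_le:
  assumes E: "is_onb E" and G: "finite G" "G \<subseteq> E"
  shows "norm (\<Sum>e\<in>G. cinner e x *\<^sub>C e) \<le> norm (x::'a::chilbert_space)"
proof -
  let ?p = "\<Sum>e\<in>G. cinner e x *\<^sub>C e"
  have on: "cinner e f = (if e = f then 1 else 0)" if "e \<in> G" "f \<in> G" for e f
    using E G that unfolding is_onb_def by blast
  have fp: "cinner f ?p = cinner f x" if "f \<in> G" for f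
  proof -
    have "cinner f ?p = (\<Sum>e\<in>G. if e = f then cinner f x else 0)"
      unfolding cinner_sum_right by (rule sum.cong) (auto simp: cinner_simps on that)
    then show ?thesis using G that by simp
  qed
  have "cinner ?p ?p = cinner ?p x"
    unfolding cinner_sum_left cinner_scaleC_left by (rule sum.cong) (simp_all add: fp)
  then have "complex_of_real ((norm ?p)\<^sup>2) = cinner ?p x" by (simp only: cinner_self)
  then have "(norm ?p)\<^sup>2 = cmod (cinner ?p x)"
    by (metis norm_of_real abs_of_nonneg zero_le_power2)
  also have "\<dots> \<le> norm ?p * norm x" by (rule cinner_cauchy_schwarz)
  finally show ?thesis
    by (cases "norm ?p = 0") (auto simp: power2_eq_square)
qed

text \<open>Finite partial sums are contractions and eventually reproduce each vector of the span;
  approximating \<open>x\<close> by such a vector gives unconditional convergence.\<close>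

lemma onb_expansion:
  fixes x :: "'a::chilbert_space"
  assumes E: "is_onb E"
  shows "((\<lambda>e. cinner e x *\<^sub>C e) has_sum x) E"
proof -
  define P where "P G x = (\<Sum>e\<in>G. cinner e x *\<^sub>C e)" for G and x :: 'a
  have P_diff: "P G (a - b) = P G a - P G b" for G a b
    by (simp add: P_def cinner_simps complex_vector.scale_left_diff_distrib sum_subtractf)
  \<comment> \<open>\<open>Q F y\<close> records that \<open>F\<close> supports \<open>y\<close>:
    the partial sum over any larger finite subset of \<open>E\<close> is already
    \<open>y\<close>.\<close>
  define Q where "Q F y \<longleftrightarrow> (\<forall>G. finite G \<longrightarrow> F \<subseteq> G \<longrightarrow> G \<subseteq> E \<longrightarrow> P G y = y)" for F y
  have QD: "Q F y \<Longrightarrow> finite G \<Longrightarrow> F \<subseteq> G \<Longrightarrow> G \<subseteq> E \<Longrightarrow> P G y = y" for F y G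
    by (simp add: Q_def)
  have span: "\<exists>F. finite F \<and> F \<subseteq> E \<and> Q F y"
    if "y \<in> cspan E" for y
    using that
  proof (induction rule: complex_vector.span_induct_alt)
    case base
    show ?case by (intro exI[of _ "{}"]) (auto simp: P_def Q_def)
  next
    case (step c e y)
    then obtain F where F: "finite F" "F \<subseteq> E" "Q F y"
      by blast
    have "P G (c *\<^sub>C e + y) = c *\<^sub>C e + y" if "finite G" "insert e F \<subseteq> G" "G \<subseteq> E" for G
    proof -
      have "P G e = (\<Sum>f\<in>G. if f = e then f else 0)"
      unfolding P_def
      proof (rule sum.cong)
        fix f assume "f \<in> G"
        then have "cinner f e = (if f = e then 1 else 0)"
          using E step(1) that(3) unfolding is_onb_def by blast
        then show "cinner f e *\<^sub>C f = (if f = e then f else 0)" by simp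
      qed simp
      then have "P G e = e" using that by (simp del: complex_vector.scale_sum_left)
      moreover have "P G (c *\<^sub>C e + y) = c *\<^sub>C P G e + P G y"
        by (simp add: P_def cinner_simps complex_vector.scale_left_distrib sum.distrib
            complex_vector.scale_sum_right scaleC_scaleC)
      ultimately show ?thesis using QD[OF F(3), of G] that by simp
    qed
    then have "Q (insert e F) (c *\<^sub>C e + y)" by (simp add: Q_def)
    then show ?case using F(1,2) step(1) by (intro exI[of _ "insert e F"]) auto
  qed
  show ?thesis
    unfolding has_sum_def tendsto_iff eventually_finite_subsets_at_top P_def[symmetric]
  proof (intro allI impI)
    fix \<epsilon> :: real assume "\<epsilon> > 0"
    have "x \<in> closure (cspan E)" using E by (simp add: is_onb_def)
    then obtain y where y: "y \<in> cspan E" "dist y x < \<epsilon> / 2"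
      using \<open>\<epsilon> > 0\<close> unfolding closure_approachable by (meson half_gt_zero)
    obtain F where F: "finite F" "F \<subseteq> E" "Q F y"
      using span[OF y(1)] by blast
    have "dist (P G x) x < \<epsilon>" if "finite G" "F \<subseteq> G" "G \<subseteq> E" for G
    proof -
      have "P G x - x = P G (x - y) + (y - x)" using QD[OF F(3) that] by (simp add: P_diff)
      then have "norm (P G x - x) \<le> norm (P G (x - y)) + norm (y - x)"
        by (metis norm_triangle_ineq)
      also have "norm (P G (x - y)) \<le> norm (x - y)"
        unfolding P_def by (rule norm_projection_le[OF E that(1,3)])
      finally show ?thesis using y(2) by (simp add: dist_norm norm_minus_commute)
    qed
    then show "\<exists>X. finite X \<and> X \<subseteq> E \<and> (\<forall>Y. finite Y \<and> X \<subseteq> Y \<and> Y \<subseteq> E \<longrightarrow> dist (P Y x) x < \<epsilon>)"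
      using F(1,2) by blast
  qed
qed

section \<open>Parseval identities and the trace of a rank one series\<close>

lemma onb_parseval:
  fixes x y :: "'a::chilbert_space"
  assumes "is_onb E"
  shows "((\<lambda>e. cinner y e * cinner e x) has_sum cinner y x) E"
  using has_sum_bounded_linear[OF bounded_bilinear.bounded_linear_right[OF bounded_bilinear_cinner]
      onb_expansion[OF assms], of y]
  by (simp add: cinner_simps mult.commute)

lemma cinner_mult_commute: "cinner x e * cinner e x = complex_of_real ((cmod (cinner e x))\<^sup>2)"
  for x e :: "'a::chilbert_space"
  by (subst cinner_commute) (simp only: complex_norm_square mult.commute)

lemma onb_parseval_norm:
  fixes x :: "'a::chilbert_space"
  assumes "is_onb E"
  shows "((\<lambda>e. (cmod (cinner e x))\<^sup>2) has_sum (norm x)\<^sup>2) E"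
  using has_sum_bounded_linear[OF bounded_linear_Re onb_parseval[OF assms, of x x]]
  by (simp add: cinner_mult_commute cinner_self del: of_real_power)

text \<open>\<open>h e\<close> is the diagonal entry at \<open>e\<close> of the operator \<Sum>_k
  |u_k><v_k|. The double family over \<open>k\<close> and \<open>e\<close> is absolutely summable,
  so the sums may be exchanged; Parseval then evaluates the sum over \<open>e\<close>.\<close>

lemma rank_one_series_trace:
  fixes u v :: "nat \<Rightarrow> 'a::chilbert_space"
  assumes E: "is_onb E"
    and u: "(\<lambda>k. (norm (u k))\<^sup>2) summable_on UNIV" and v: "(\<lambda>k. (norm (v k))\<^sup>2) summable_on UNIV"
    and h: "\<And>e. e \<in> E \<Longrightarrow> ((\<lambda>k. cinner e (u k) * cinner (v k) e) has_sum h e) UNIV"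
  shows "(h has_sum (\<Sum>\<^sub>\<infinity>k. cinner (v k) (u k))) E"
    and "(\<lambda>k. cinner (v k) (u k)) summable_on UNIV"
proof -
  define a where "a = (\<lambda>(k, e). cinner e (u k) * cinner (v k) e)"
  have sq: "(\<lambda>(k, e). (cmod (cinner e (w k)))\<^sup>2) summable_on UNIV \<times> E"
    if "(\<lambda>k. (norm (w k))\<^sup>2) summable_on UNIV" for w :: "nat \<Rightarrow> 'a"
    using that onb_parseval_norm[OF E] by (intro summable_on_SigmaI) auto
  have "(\<lambda>x. norm (a x)) summable_on UNIV \<times> E"
  \<comment> \<open>Each product is dominated by the sum of two squares, whose double sums reduce by
    Parseval to sums of squared norms.\<close>
  proof (rule Infinite_Sum.abs_summable_on_comparison_test')
    show "(\<lambda>(k, e). (cmod (cinner e (u k)))\<^sup>2 + (cmod (cinner e (v k)))\<^sup>2) summable_on UNIV \<times> E"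
      using summable_on_add[OF sq[OF u] sq[OF v]] by (simp add: case_prod_unfold)
    fix x :: "nat \<times> 'a"
    obtain k e where x: "x = (k, e)" by (cases x)
    have "cmod (cinner (v k) e) = cmod (cinner e (v k))" by (subst cinner_commute) simp
    moreover have "p * q \<le> p\<^sup>2 + q\<^sup>2" if "p \<ge> 0" "q \<ge> 0" for p q :: real
      using sum_squares_bound[of p q] mult_nonneg_nonneg[OF that] by linarith
    ultimately show "norm (a x) \<le> (case x of (k, e) \<Rightarrow> (cmod (cinner e (u k)))\<^sup>2 + (cmod (cinner e (v k)))\<^sup>2)"
      by (simp add: a_def x norm_mult)
  qed
  then have a: "a summable_on UNIV \<times> E" by (rule Infinite_Sum.abs_summable_summable)
  have fibre: "((\<lambda>e. a (k, e)) has_sum cinner (v k) (u k)) E" for k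
    using onb_parseval[OF E, of "v k" "u k"] by (simp add: a_def mult.commute)
  obtain S where S: "(a has_sum S) (UNIV \<times> E)" using a unfolding summable_on_def by blast
  have s: "((\<lambda>k. cinner (v k) (u k)) has_sum S) UNIV" by (rule has_sum_SigmaD[OF S fibre])
  then show "(\<lambda>k. cinner (v k) (u k)) summable_on UNIV" unfolding summable_on_def by blast
  have "((\<lambda>(e, k). a (k, e)) has_sum S) (E \<times> UNIV)" using S has_sum_swap by blast
  then have "(h has_sum S) E" by (rule has_sum_SigmaD) (use h in \<open>simp add: a_def\<close>)
  then show "(h has_sum (\<Sum>\<^sub>\<infinity>k. cinner (v k) (u k))) E" using infsumI[OF s] by simp
qed

section \<open>Decomposition of a positive trace class operator into rank one operators\<close>

lemma positive_op_cinner: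
  assumes "positive_op S"
  shows "cinner x (S x) = complex_of_real (Re (cinner x (S x)))"
  using assms by (simp add: positive_op_def complex_eq_iff)

text \<open>Polarisation: the quadratic form is real at \<open>x + y\<close> and at
  \<open>x + \<i> *\<^sub>C y\<close>, which yields the imaginary and the real part of the
  identity.\<close>

lemma positive_op_hermitian:
  assumes S: "positive_op S"
  shows "cinner (S x) y = cinner x (S y)"
proof -
  have b: "bounded_clinear S" and im: "Im (cinner z (S z)) = 0" for z
    using S by (auto simp: positive_op_def)
  note [simp] = bounded_clinear_simps(1,5)[OF b]
  have "Im (cinner x (S y)) = - Im (cinner y (S x))"
    using im[of "x + y"] im[of x] im[of y] by (simp add: cinner_simps)
  moreover have "Re (cinner x (S y)) = Re (cinner y (S x))"
    using im[of "x + \<i> *\<^sub>C y"] im[of x] im[of y] by (simp add: cinner_simps)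
  ultimately have "cinner x (S y) = cnj (cinner y (S x))" by (simp add: complex_eq_iff)
  then show ?thesis by (metis cinner_commute)
qed

text \<open>The discriminant argument for a positive semidefinite form, evaluated at
  \<open>y - c *\<^sub>C x\<close> with \<open>c\<close> a real multiple of
  \<open>p = cinner x (S y)\<close>.\<close>

lemma positive_op_cauchy_schwarz:
  assumes S: "positive_op S"
  shows "(cmod (cinner x (S y)))\<^sup>2 \<le> Re (cinner x (S x)) * Re (cinner y (S y))"
proof -
  have b: "bounded_clinear S" and pos: "Re (cinner z (S z)) \<ge> 0" for z
    using S by (auto simp: positive_op_def)
  define p where "p = cinner x (S y)"
  have q: "cinner y (S x) = cnj p"
    by (metis p_def positive_op_hermitian[OF S] cinner_commute)
  have ineq: "0 \<le> Re (cinner y (S y)) - 2 * r * (cmod p)\<^sup>2 + r\<^sup>2 * (cmod p)\<^sup>2 * Re (cinner x (S x))"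
    for r :: real
  proof -
    define c where "c = complex_of_real r * p"
    have "cinner (y - c *\<^sub>C x) (S (y - c *\<^sub>C x)) = cinner y (S y) - c * cnj p - cnj c * p
        + c * cnj c * cinner x (S x)"
      by (simp add: bounded_clinear_simps[OF b] cinner_simps q p_def[symmetric] algebra_simps)
    also have "c * cnj p = complex_of_real (r * (cmod p)\<^sup>2)"
      by (simp only: c_def of_real_mult complex_norm_square mult.assoc)
    also have "cnj c * p = complex_of_real (r * (cmod p)\<^sup>2)"
      by (simp only: c_def of_real_mult complex_norm_square complex_cnj_mult complex_cnj_complex_of_real mult_ac)
    also have "c * cnj c = complex_of_real (r\<^sup>2 * (cmod p)\<^sup>2)"
      by (simp only: c_def of_real_mult complex_norm_square complex_cnj_mult complex_cnj_complex_of_real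
          power2_eq_square[of r] mult_ac)
    also have "cinner y (S y) - complex_of_real (r * (cmod p)\<^sup>2) - complex_of_real (r * (cmod p)\<^sup>2)
        + complex_of_real (r\<^sup>2 * (cmod p)\<^sup>2) * cinner x (S x)
      = complex_of_real (Re (cinner y (S y)) - 2 * r * (cmod p)\<^sup>2
        + r\<^sup>2 * (cmod p)\<^sup>2 * Re (cinner x (S x)))"
      by (subst positive_op_cinner[OF S, of x], subst positive_op_cinner[OF S, of y]) simp
    finally show ?thesis using pos[of "y - c *\<^sub>C x"] by simp
  qed
  show ?thesis
  proof (cases "Re (cinner x (S x)) = 0")
    case True
    have "(cmod p)\<^sup>2 = 0"
    proof (rule ccontr)
      assume "(cmod p)\<^sup>2 \<noteq> 0"
      \<comment> \<open>With the quadratic term gone the right-hand side is affine in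
        \<open>r\<close>, and the chosen \<open>r\<close> makes it equal to -1.\<close>
      then show False
        using ineq[of "(Re (cinner y (S y)) + 1) / (2 * (cmod p)\<^sup>2)"] True by simp
    qed
    then show ?thesis by (simp add: True p_def)
  next
    case False
    then have q0: "Re (cinner x (S x)) > 0" using pos[of x] by linarith
    \<comment> \<open>The value \<open>1 / Re (cinner x (S x))\<close> is the minimiser of the
      quadratic in \<open>r\<close>.\<close>
    show ?thesis
      using ineq[of "1 / Re (cinner x (S x))"] q0
      by (simp add: p_def[symmetric] power2_eq_square field_simps)
  qed
qed

text \<open>A Cholesky column: subtracting |g><g| with \<open>g = deflate S e\<close> is the Schur
  complement step that removes the direction \<open>e\<close>. If
  \<open>Re (cinner e (S e)) = 0\<close>, division by zero gives \<open>g = 0\<close>, which fits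
  because a positive \<open>S\<close> then has \<open>S e = 0\<close>.\<close>

definition deflate :: "('a::chilbert_space \<Rightarrow> 'a) \<Rightarrow> 'a \<Rightarrow> 'a" where
  "deflate S e = (1 / sqrt (Re (cinner e (S e)))) *\<^sub>R S e"

lemma cinner_deflate:
  assumes S: "positive_op S"
  shows "cinner (deflate S e) x = cinner e (S x) / complex_of_real (sqrt (Re (cinner e (S e))))"
  by (simp add: deflate_def cinner_simps positive_op_hermitian[OF S])

text \<open>Positivity of the Schur complement is the Cauchy-Schwarz inequality for the form of
  \<open>S\<close>, divided by \<open>Re (cinner e (S e))\<close>.\<close>

lemma positive_op_deflate:
  assumes S: "positive_op S"
  shows "positive_op (\<lambda>x. S x - ketbra (deflate S e) (deflate S e) x)"
proof -
  let ?g = "deflate S e"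
  have b: "bounded_clinear S" using S by (simp add: positive_op_def)
  have eq: "cinner x (S x - ketbra ?g ?g x) = complex_of_real (Re (cinner x (S x)) - (cmod (cinner ?g x))\<^sup>2)" for x
    using positive_op_cinner[OF S, of x] cinner_mult_commute[of x ?g]
    by (simp add: ketbra_def cinner_simps mult.commute)
  have le: "(cmod (cinner ?g x))\<^sup>2 \<le> Re (cinner x (S x))" for x
  proof (cases "Re (cinner e (S e)) = 0")
    case True
    then show ?thesis using S by (simp add: cinner_deflate[OF S] positive_op_def)
  next
    case False
    then have "Re (cinner e (S e)) > 0" using S by (simp add: positive_op_def order_less_le)
    then show ?thesis
      using positive_op_cauchy_schwarz[OF S, of e x]
      by (simp add: cinner_deflate[OF S] norm_divide power_divide field_simps)
  qed
  have "bounded_clinear (\<lambda>x. S x - ketbra ?g ?g x)"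
    by (intro bounded_clinear_diff b bounded_clinear_ketbra)
  then show ?thesis using le unfolding positive_op_def eq by simp
qed

text \<open>\<open>cinner (deflate S e) e\<close> is the square root of
  \<open>cinner e (S e)\<close>, so the subtracted term takes the value \<open>S e\<close> at
  \<open>e\<close>. The kernel of \<open>S\<close> is kept because
  \<open>cinner (deflate S e) x\<close> is a multiple of \<open>cinner e (S x)\<close>.\<close>

lemma deflate_kills:
  assumes S: "positive_op S"
  shows "S e - ketbra (deflate S e) (deflate S e) e = 0"
    and "S x = 0 \<Longrightarrow> S x - ketbra (deflate S e) (deflate S e) x = 0"
proof -
  show "S x = 0 \<Longrightarrow> S x - ketbra (deflate S e) (deflate S e) x = 0"
    by (simp add: ketbra_def cinner_deflate[OF S])
  define q where "q = Re (cinner e (S e))"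
  have q: "cinner e (S e) = complex_of_real q" "q \<ge> 0"
    using positive_op_cinner[OF S, of e] S by (auto simp: q_def positive_op_def)
  show "S e - ketbra (deflate S e) (deflate S e) e = 0"
  proof (cases "q = 0")
    case True
    have "(cmod (cinner (S e) (S e)))\<^sup>2 \<le> 0"
      using positive_op_cauchy_schwarz[OF S, of "S e" e] True by (simp add: q_def)
    then have "S e = 0" by (simp add: cinner_self)
    then show ?thesis by (simp add: ketbra_def deflate_def)
  next
    case False
    then have "sqrt q * sqrt q = q" "sqrt q \<noteq> 0" using q(2) by auto
    then have "complex_of_real q / complex_of_real (sqrt q) * complex_of_real (1 / sqrt q) = 1"
      using False unfolding of_real_divide[symmetric] of_real_mult[symmetric] by simp
    moreover have "cinner (deflate S e) e = complex_of_real q / complex_of_real (sqrt q)"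
      by (simp add: cinner_deflate[OF S] q)
    moreover have "deflate S e = complex_of_real (1 / sqrt q) *\<^sub>C S e"
      unfolding deflate_def q_def scaleR_scaleC ..
    ultimately show ?thesis by (simp only: ketbra_def scaleC_scaleC complex_vector.scale_one diff_self)
  qed
qed

primrec deflations :: "('a::chilbert_space \<Rightarrow> 'a) \<Rightarrow> (nat \<Rightarrow> 'a) \<Rightarrow> nat \<Rightarrow> 'a \<Rightarrow> 'a" where
  "deflations S e 0 = S"
| "deflations S e (Suc n) = (\<lambda>x. deflations S e n x
     - ketbra (deflate (deflations S e n) (e n)) (deflate (deflations S e n) (e n)) x)"

text \<open>This is the Cholesky decomposition along an enumeration of the basis vectors on which
  \<open>S\<close> does not vanish.\<close>

lemma positive_op_rank_one_series:
  assumes S: "positive_op S" and E: "is_onb E" and sum: "(\<lambda>e. cinner e (S e)) summable_on E"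
  shows "\<exists>g. (\<forall>x y. ((\<lambda>k. cinner x (g k) * cinner (g k) y) has_sum cinner x (S y)) UNIV) \<and>
    ((\<lambda>k::nat. (norm (g k))\<^sup>2) has_sum Re (\<Sum>\<^sub>\<infinity>e\<in>E. cinner e (S e))) UNIV"
proof -
  \<comment> \<open>Summability leaves only countably many nonzero diagonal entries. The added
    \<open>0\<close> keeps the set nonempty for \<open>from_nat_into\<close>; deflating at
    \<open>0\<close> subtracts nothing.\<close>
  let ?C = "insert 0 {e\<in>E. cinner e (S e) \<noteq> 0}"
  define e where "e = from_nat_into ?C"
  have "countable {e\<in>E. cinner e (S e) \<noteq> 0}"
    using sum by (intro Infinite_Sum.abs_summable_countable) (simp add: summable_on_iff_abs_summable_on_complex)
  then have "countable ?C" by simp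
  then have e: "range e = ?C" unfolding e_def by (intro range_from_nat_into) auto
  define R where "R = deflations S e"
  define g where "g n = deflate (R n) (e n)" for n
  have R_Suc: "R (Suc n) x = R n x - cinner (g n) x *\<^sub>C g n" for n x
    by (simp add: R_def g_def ketbra_def)
  have R_pos: "positive_op (R n)" for n
    by (induction n) (auto simp: R_def S intro: positive_op_deflate)
  have bR: "bounded_clinear (R n)" for n using R_pos by (simp add: positive_op_def)
  have R_partial: "cinner x (S y) = cinner x (R n y) + (\<Sum>k<n. cinner x (g k) * cinner (g k) y)"
    for n x y
    by (induction n) (simp_all add: R_def[THEN fun_cong, of 0] R_Suc cinner_simps)
  \<comment> \<open>The rank one pieces removed so far are positive, so every remainder is dominated
    by \<open>S\<close>. This gives bounds uniform in \<open>n\<close>.\<close>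
  have R_le: "Re (cinner x (R n x)) \<le> Re (cinner x (S x))" for n x
    unfolding R_partial[of x x n] by (simp add: cinner_mult_commute Re_sum sum_nonneg del: of_real_power)
  define M where "M = onorm S"
  have M0: "M \<ge> 0" unfolding M_def
    using S by (intro onorm_pos_le bounded_clinear_imp_bounded_linear) (simp add: positive_op_def)
  have R_M: "Re (cinner x (R n x)) \<le> M * (norm x)\<^sup>2" for n x
  proof -
    have "Re (cinner x (R n x)) \<le> norm x * norm (S x)"
      using R_le[of x n] complex_Re_le_cmod cinner_cauchy_schwarz by (meson order_trans)
    also have "norm x * norm (S x) \<le> norm x * (M * norm x)"
      unfolding M_def using S
      by (intro mult_left_mono bounded_clinear_simps(8)) (simp_all add: positive_op_def)
    finally show ?thesis by (simp add: power2_eq_square mult_ac)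
  qed
  have R_bound: "cmod (cinner x (R n y)) \<le> M * norm x * norm y" for n x y
  proof -
    have "(cmod (cinner x (R n y)))\<^sup>2 \<le> (M * (norm x)\<^sup>2) * (M * (norm y)\<^sup>2)"
    proof (rule order_trans[OF positive_op_cauchy_schwarz[OF R_pos, of x n y]], rule mult_mono)
      show "0 \<le> Re (cinner y (R n y))" using R_pos[of n] by (simp add: positive_op_def)
    qed (use R_M M0 in auto)
    also have "\<dots> = (M * norm x * norm y)\<^sup>2" by (simp add: power2_eq_square)
    finally show ?thesis using M0 by (auto intro: power2_le_imp_le)
  qed
  have R_keep: "R m x = 0" if "R n x = 0" "n \<le> m" for n m x
    using that(2,1)
  proof (induction rule: dec_induct)
    case (step m)
    then show ?case using deflate_kills(2)[OF R_pos, of m x "e m"] by (simp add: R_def)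
  qed simp
  \<comment> \<open>A basis vector with vanishing diagonal entry is annihilated by \<open>S\<close>
    itself; any other one is annihilated once the enumeration has reached it.\<close>
  have R_E: "\<exists>n. R n f = 0" if "f \<in> E" for f
  proof (cases "cinner f (S f) = 0")
    case True
    have "(cmod (cinner (S f) (S f)))\<^sup>2 \<le> 0"
      using positive_op_cauchy_schwarz[OF S, of "S f" f] True by simp
    then have "R 0 f = 0" by (simp add: cinner_self R_def)
    then show ?thesis by blast
  next
    case False
    then have "f \<in> range e" unfolding e using that by simp
    then obtain n where n: "f = e n" by blast
    have "R (Suc n) f = 0" using deflate_kills(1)[OF R_pos, of n f] by (simp add: R_def n)
    then show ?thesis by blast
  qed
  have R_span: "\<exists>n. \<forall>m\<ge>n. R m y = 0" if "y \<in> cspan E" for y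
    using that
  proof (induction rule: complex_vector.span_induct_alt)
    case base
    show ?case by (simp add: bounded_clinear_simps[OF bR])
  next
    case (step c f y)
    then obtain n k where "\<forall>m\<ge>n. R m y = 0" "R k f = 0" using R_E by blast
    then show ?case using R_keep[of k f]
      by (intro exI[of _ "max n k"]) (simp add: bounded_clinear_simps[OF bR])
  qed
  \<comment> \<open>The remainders are uniformly bounded and eventually vanish on each vector of the
    dense span, hence tend weakly to zero.\<close>
  have R_lim: "(\<lambda>n. cinner x (R n y)) \<longlonglongrightarrow> 0" for x y
  proof (rule LIMSEQ_I)
    fix \<epsilon> :: real assume \<epsilon>: "\<epsilon> > 0"
    \<comment> \<open>The \<open>+ 1\<close> keeps the denominator positive when
      \<open>M * norm x = 0\<close>.\<close>
    define \<delta> where "\<delta> = \<epsilon> / (M * norm x + 1)"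
    have "M * norm x + 1 > 0" using M0 by (simp add: add_nonneg_pos)
    then have \<delta>: "\<delta> > 0" "(M * norm x + 1) * \<delta> = \<epsilon>" using \<epsilon> by (auto simp: \<delta>_def)
    have "y \<in> closure (cspan E)" using E by (simp add: is_onb_def)
    then obtain z where z: "z \<in> cspan E" "dist z y < \<delta>"
      using \<delta>(1) unfolding closure_approachable by meson
    obtain n where n: "\<And>m. m \<ge> n \<Longrightarrow> R m z = 0" using R_span[OF z(1)] by blast
    have "norm (cinner x (R m y) - 0) < \<epsilon>" if "m \<ge> n" for m
    proof -
      have "cinner x (R m y) = cinner x (R m (y - z))"
        using n[OF that] by (simp add: bounded_clinear_simps[OF bR])
      then have "cmod (cinner x (R m y)) \<le> M * norm x * norm (y - z)" using R_bound by simp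
      also have "\<dots> \<le> M * norm x * \<delta>"
        using z(2) M0 by (intro mult_left_mono) (auto simp: dist_norm norm_minus_commute)
      also have "\<dots> < \<epsilon>" using \<delta> by (simp add: algebra_simps)
      finally show ?thesis by simp
    qed
    then show "\<exists>no. \<forall>n\<ge>no. norm (cinner x (R n y) - 0) < \<epsilon>" by blast
  qed
  have g_sums: "(\<lambda>k. cinner x (g k) * cinner (g k) y) sums cinner x (S y)" for x y
  proof -
    have "(\<Sum>k<n. cinner x (g k) * cinner (g k) y) = cinner x (S y) - cinner x (R n y)" for n
      using R_partial[of x y n] by simp
    then show ?thesis
      using tendsto_diff[OF tendsto_const R_lim[of x y], of "cinner x (S y)"] by (simp add: sums_def)
  qed
  \<comment> \<open>On the diagonal the terms are nonnegative, which upgrades convergence of the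
    ordered series to unconditional summability. These squares then dominate the off-diagonal
    series.\<close>
  have g_sq: "((\<lambda>k. (cmod (cinner (g k) x))\<^sup>2) has_sum Re (cinner x (S x))) UNIV" for x
    using sums_Re[OF g_sums[of x x]]
    by (intro sums_nonneg_imp_has_sum) (simp_all add: cinner_mult_commute del: of_real_power)
  have g_has_sum: "((\<lambda>k. cinner x (g k) * cinner (g k) y) has_sum cinner x (S y)) UNIV" for x y
  proof (rule norm_summable_imp_has_sum[OF _ g_sums])
    have "summable (\<lambda>k. (cmod (cinner (g k) x))\<^sup>2 + (cmod (cinner (g k) y))\<^sup>2)"
      using g_sq[THEN has_sum_imp_sums, THEN sums_summable] by (intro summable_add)
    then show "summable (\<lambda>k. norm (cinner x (g k) * cinner (g k) y))"
    proof (rule summable_comparison_test'[where N = 0])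
      fix k
      have "cmod (cinner x (g k)) = cmod (cinner (g k) x)" by (subst cinner_commute) simp
      moreover have "p * q \<le> p\<^sup>2 + q\<^sup>2" if "p \<ge> 0" "q \<ge> 0" for p q :: real
        using sum_squares_bound[of p q] mult_nonneg_nonneg[OF that] by linarith
      ultimately show "norm (norm (cinner x (g k) * cinner (g k) y))
          \<le> (cmod (cinner (g k) x))\<^sup>2 + (cmod (cinner (g k) y))\<^sup>2"
        by (simp add: norm_mult)
    qed
  qed
  have "((\<lambda>k. (norm (g k))\<^sup>2) has_sum Re (\<Sum>\<^sub>\<infinity>f\<in>E. cinner f (S f))) UNIV"
  proof -
    \<comment> \<open>Summed over \<open>k\<close> first, this family gives the diagonal entries of
      \<open>S\<close>; summed over \<open>f\<close> first, it gives
      \<open>(norm (g k))\<^sup>2\<close>. Nonnegativity supplies the joint summability needed for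
      the exchange.\<close>
    let ?a = "\<lambda>(f, k). (cmod (cinner (g k) f))\<^sup>2"
    have trE: "((\<lambda>f. Re (cinner f (S f))) has_sum Re (\<Sum>\<^sub>\<infinity>f\<in>E. cinner f (S f))) E"
      using has_sum_bounded_linear[OF bounded_linear_Re has_sum_infsum[OF sum]] .
    have "?a summable_on E \<times> UNIV"
      using g_sq trE by (intro summable_on_SigmaI) (auto simp: summable_on_def)
    then have "(?a has_sum Re (\<Sum>\<^sub>\<infinity>f\<in>E. cinner f (S f))) (E \<times> UNIV)"
      using g_sq trE by (intro has_sum_SigmaI) auto
    then have "((\<lambda>(k, f). ?a (f, k)) has_sum Re (\<Sum>\<^sub>\<infinity>f\<in>E. cinner f (S f))) (UNIV \<times> E)"
      using has_sum_swap by blast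
    then show ?thesis
    proof (rule has_sum_SigmaD)
      fix k
      have "cmod (cinner f (g k)) = cmod (cinner (g k) f)" for f by (subst cinner_commute) simp
      then show "((\<lambda>f. case (k, f) of (k, f) \<Rightarrow> ?a (f, k)) has_sum (norm (g k))\<^sup>2) E"
        using onb_parseval_norm[OF E, of "g k"] by simp
    qed
  qed
  with g_has_sum show ?thesis by blast
qed

section \<open>Extension of bounded operators from dense subspaces\<close>

text \<open>The operator is given on a dense subspace by its graph \<open>D\<close>; the graph of the
  extension is the closure of \<open>D\<close>.\<close>

lemma bounded_clinear_extension:
  fixes D :: "('a::chilbert_space \<times> 'b::chilbert_space) set"
  assumes add: "\<And>v w v' w'. (v, w) \<in> D \<Longrightarrow> (v', w') \<in> D \<Longrightarrow> (v + v', w + w') \<in> D"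
    and scale: "\<And>c v w. (v, w) \<in> D \<Longrightarrow> (c *\<^sub>C v, c *\<^sub>C w) \<in> D"
    and bound: "\<And>v w. (v, w) \<in> D \<Longrightarrow> norm w \<le> M * norm v"
    and dense: "closure (fst ` D) = UNIV"
  shows "\<exists>X. bounded_clinear X \<and> (\<forall>(v, w)\<in>D. X v = w) \<and> (\<forall>v. norm (X v) \<le> M * norm v)"
proof -
  define L where "L v w \<longleftrightarrow> (\<exists>f g. (\<forall>n::nat. (f n, g n) \<in> D) \<and> f \<longlonglongrightarrow> v \<and> g \<longlonglongrightarrow> w)" for v w
  have D_diff: "(v - v', w - w') \<in> D" if "(v, w) \<in> D" "(v', w') \<in> D" for v w v' w'
    using add[OF that(1) scale[OF that(2), of "-1"]]
    by (simp add: complex_vector.scale_minus_left)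
  have L_bound: "norm w \<le> M * norm v" if "L v w" for v w
  proof -
    obtain f g where fg: "\<And>n::nat. (f n, g n) \<in> D" "f \<longlonglongrightarrow> v" "g \<longlonglongrightarrow> w"
      using \<open>L v w\<close> unfolding L_def by blast
    show ?thesis
      by (rule LIMSEQ_le[OF tendsto_norm[OF fg(3)] tendsto_mult_left[OF tendsto_norm[OF fg(2)]]])
         (use bound fg(1) in blast)
  qed
  have L_add: "L (v + v') (w + w')" if L: "L v w" "L v' w'" for v w v' w'
  proof -
    obtain f g f' g' where "\<And>n::nat. (f n, g n) \<in> D" "f \<longlonglongrightarrow> v" "g \<longlonglongrightarrow> w"
      "\<And>n::nat. (f' n, g' n) \<in> D" "f' \<longlonglongrightarrow> v'" "g' \<longlonglongrightarrow> w'"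
      using L unfolding L_def by blast
    then show ?thesis
      unfolding L_def
      by (intro exI[of _ "\<lambda>n. f n + f' n"] exI[of _ "\<lambda>n. g n + g' n"]) (auto intro: add tendsto_add)
  qed
  have L_scale: "L (c *\<^sub>C v) (c *\<^sub>C w)" if L: "L v w" for c v w
  proof -
    obtain f g where fg: "\<And>n::nat. (f n, g n) \<in> D" "f \<longlonglongrightarrow> v" "g \<longlonglongrightarrow> w"
      using L unfolding L_def by blast
    show ?thesis
      unfolding L_def using fg
      by (intro exI[of _ "\<lambda>n. c *\<^sub>C f n"] exI[of _ "\<lambda>n. c *\<^sub>C g n"])
         (auto intro: scale bounded_linear.tendsto[OF bounded_clinear_imp_bounded_linear[OF bounded_clinear_scaleC]])
  qed
  \<comment> \<open>The bound applied to a difference with first component 0 makes the relation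
    single-valued, so several representations of one vector in \<open>D\<close> do no harm.\<close>
  have L_unique: "w = w'" if "L v w" "L v w'" for v w w'
  proof -
    have "L (v - v) (w - w')"
      using L_add[OF that(1) L_scale[OF that(2), of "-1"]]
      by (simp add: complex_vector.scale_minus_left)
    from L_bound[OF this] show ?thesis by simp
  qed
  have D_L: "L v w" if "(v, w) \<in> D" for v w
    unfolding L_def using that by (intro exI[of _ "\<lambda>_. v"] exI[of _ "\<lambda>_. w"]) auto
  have "\<exists>w. L v w" for v
  proof -
    have "v \<in> closure (fst ` D)" using dense by simp
    then obtain f where f: "\<And>n::nat. f n \<in> fst ` D" "f \<longlonglongrightarrow> v"
      unfolding closure_sequential by blast
    have "\<forall>n. \<exists>w. (f n, w) \<in> D" using f(1) by (force simp: image_iff)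
    then obtain g where g: "\<And>n. (f n, g n) \<in> D" by metis
    have "Cauchy g"
    proof (rule metric_CauchyI)
      fix e :: real assume "e > 0"
      \<comment> \<open>\<open>\<bar>M\<bar> + 1\<close> is a positive Lipschitz constant whatever
        the sign of \<open>M\<close>.\<close>
      have "\<bar>M\<bar> + 1 > 0" by simp
      with \<open>e > 0\<close> have "e / (\<bar>M\<bar> + 1) > 0" by simp
      then obtain N where N: "\<And>m n. m \<ge> N \<Longrightarrow> n \<ge> N \<Longrightarrow> dist (f m) (f n) < e / (\<bar>M\<bar> + 1)"
        using metric_CauchyD[OF LIMSEQ_imp_Cauchy[OF f(2)]] by blast
      have "dist (g m) (g n) < e" if "m \<ge> N" "n \<ge> N" for m n
      proof -
        have "dist (g m) (g n) \<le> M * dist (f m) (f n)"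
          using bound[OF D_diff[OF g g]] by (simp add: dist_norm)
        also have "\<dots> \<le> (\<bar>M\<bar> + 1) * dist (f m) (f n)" by (intro mult_right_mono) auto
        also have "\<dots> < e" using N[OF that] \<open>\<bar>M\<bar> + 1 > 0\<close> by (simp add: pos_less_divide_eq mult.commute)
        finally show ?thesis .
      qed
      then show "\<exists>N. \<forall>m\<ge>N. \<forall>n\<ge>N. dist (g m) (g n) < e" by blast
    qed
    then obtain w where "g \<longlonglongrightarrow> w" using Cauchy_convergent convergent_def by blast
    then show ?thesis using f(2) g unfolding L_def by blast
  qed
  then obtain X where X: "\<And>v. L v (X v)" by metis
  have X_eq: "X v = w" if "L v w" for v w using L_unique[OF X that] .
  have "bounded_clinear X"
    by (rule bounded_clinearI[where M = M]) (auto intro: X_eq L_add L_scale X L_bound)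
  then show ?thesis using X_eq D_L L_bound X by blast
qed

section \<open>Tensor products of operators\<close>

lemma tensor2_simps:
  assumes "hilbert_tensor2 s"
  shows "s (x + y) z = s x z + s y z" "s x' (y' + z') = s x' y' + s x' z'"
    "s (c *\<^sub>C x) z = c *\<^sub>C s x z" "s x (c *\<^sub>C z) = c *\<^sub>C s x z"
    "cinner (s x z) (s y z') = cinner x y * cinner z z'"
    "s 0 z = 0" "s x 0 = 0"
    "norm (s x z) = norm x * norm z"
proof -
  show "s (x + y) z = s x z + s y z" "s x' (y' + z') = s x' y' + s x' z'"
    using assms unfolding hilbert_tensor2_def by blast+
  show sc: "s (c *\<^sub>C x) z = c *\<^sub>C s x z" "s x (c *\<^sub>C z) = c *\<^sub>C s x z" for c x z
    using assms unfolding hilbert_tensor2_def by blast+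
  show ip: "cinner (s x z) (s y z') = cinner x y * cinner z z'" for x y z z'
    using assms unfolding hilbert_tensor2_def by blast
  show "s 0 z = 0" "s x 0 = 0" using sc(1)[where c = 0] sc(2)[where c = 0] by simp_all
  have "complex_of_real ((norm (s x z))\<^sup>2) = complex_of_real ((norm x * norm z)\<^sup>2)"
    unfolding cinner_self[symmetric] ip by (simp add: cinner_self power_mult_distrib)
  then have "(norm (s x z))\<^sup>2 = (norm x * norm z)\<^sup>2" unfolding of_real_eq_iff .
  then show "norm (s x z) = norm x * norm z" by (simp add: power2_eq_iff_nonneg)
qed

lemma tensor2_dense:
  assumes "hilbert_tensor2 s"
  shows "closure (cspan (range (\<lambda>(x, y). s x y))) = UNIV"
  using assms unfolding hilbert_tensor2_def by blast

lemma tensor2_swap: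
  assumes "hilbert_tensor2 s"
  shows "hilbert_tensor2 (\<lambda>y x. s x y)"
proof -
  have "range (\<lambda>(y, x). s x y) = range (\<lambda>(x, y). s x y)" by auto
  then show ?thesis using assms unfolding hilbert_tensor2_def by (simp add: mult.commute)
qed

lemma eq_on_tensor2:
  assumes "hilbert_tensor2 s" "bounded_clinear X" "bounded_clinear Y"
    and "\<And>x y. X (s x y) = Y (s x y)"
  shows "X = Y"
  using assms by (intro eq_on_dense[OF _ _ tensor2_dense[OF assms(1)]]) auto

text \<open>Bounded operators agreeing on elementary tensors coincide, so the definite description
  in \<open>op_tensor\<close> has exactly one candidate.\<close>

lemma op_tensor_eq:
  assumes "hilbert_tensor2 s" "bounded_clinear X" "\<And>x y. X (s x y) = s (S x) (R y)"
  shows "op_tensor s S R = X"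
  unfolding op_tensor_def
proof (rule the_equality)
  show "Y = X" if "bounded_clinear Y \<and> (\<forall>x y. Y (s x y) = s (S x) (R y))" for Y
    using eq_on_tensor2[OF assms(1) _ assms(2), of Y] that assms(3) by simp
qed (use assms in auto)

text \<open>A Gram--Schmidt step with respect to the second tensor factor splits off one elementary
  tensor orthogonally, both before and after applying \<open>S\<close> to the first factor.\<close>

lemma tensor2_finite_sum_bound:
  assumes s: "hilbert_tensor2 s" and S: "bounded_clinear S"
  shows "norm (\<Sum>(x, y)\<leftarrow>l. s (S x) y) \<le> onorm S * norm (\<Sum>(x, y)\<leftarrow>l. s x y)"
\<comment> \<open>Induction on the length, since the orthogonalised list \<open>m\<close> is as long
  as the tail of \<open>l\<close> but in general different from it.\<close>
proof (induction "length l" arbitrary: l)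
  case 0
  then show ?case by simp
next
  case (Suc n)
  then obtain a b l' where l: "l = (a, b) # l'" "length l' = n"
    by (metis length_Suc_conv surj_pair)
  \<comment> \<open>\<open>c y\<close> is the coefficient of \<open>y\<close> along
    \<open>b\<close>, with value 0 if \<open>b = 0\<close>; \<open>A\<close> collects all the first
    factors that end up attached to \<open>b\<close>.\<close>
  define c where "c y = cinner b y / cinner b b" for y
  define m where "m = map (\<lambda>(x, y). (x, y - c y *\<^sub>C b)) l'"
  define A where "A = a + (\<Sum>(x, y)\<leftarrow>l'. c y *\<^sub>C x)"
  have m_orth: "cinner b y = 0" if xy: "(x, y) \<in> set m" for x y
  proof -
    obtain z where "y = z - c z *\<^sub>C b" using xy unfolding m_def by auto
    then show ?thesis by (cases "b = 0") (simp_all add: cinner_simps c_def cinner_self)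
  qed
  have orth: "cinner (s p b) (\<Sum>(x, y)\<leftarrow>k. s (R x) y) = 0"
    if "\<And>x y. (x, y) \<in> set k \<Longrightarrow> cinner b y = 0" for p and R :: "'a \<Rightarrow> 'a" and k
    using that
  proof (induction k)
    case (Cons xy k)
    obtain x y where xy: "xy = (x, y)" by (cases xy)
    have "cinner b y = 0" by (rule Cons.prems[of x]) (simp add: xy)
    moreover have "cinner (s p b) (\<Sum>(x, y)\<leftarrow>k. s (R x) y) = 0"
    proof (rule Cons.IH)
      show "cinner b y' = 0" if "(x', y') \<in> set k" for x' y'
        by (rule Cons.prems[of x']) (simp add: that)
    qed
    ultimately show ?case by (simp add: xy cinner_simps tensor2_simps[OF s])
  qed simp
  \<comment> \<open>Stated for an arbitrary \<open>R\<close>, so that \<open>S\<close> and the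
    identity share the same \<open>A\<close> and \<open>m\<close>.\<close>
  have split: "(\<Sum>(x, y)\<leftarrow>l. s (R x) y) = s (R A) b + (\<Sum>(x, y)\<leftarrow>m. s (R x) y)"
    if R: "bounded_clinear R" for R :: "'a \<Rightarrow> 'a"
  proof -
    have "(\<Sum>(x, y)\<leftarrow>l'. s (R x) y)
        = s (R (\<Sum>(x, y)\<leftarrow>l'. c y *\<^sub>C x)) b + (\<Sum>(x, y)\<leftarrow>l'. s (R x) (y - c y *\<^sub>C b))"
    proof (induction l')
      case Nil
      then show ?case by (simp add: bounded_clinear_simps[OF R] tensor2_simps[OF s])
    next
      case (Cons xy l')
      obtain x y where xy: "xy = (x, y)" by (cases xy)
      have "s (R x) y = s (R (c y *\<^sub>C x)) b + s (R x) (y - c y *\<^sub>C b)"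
        using tensor2_simps(2)[OF s, of "R x" "c y *\<^sub>C b" "y - c y *\<^sub>C b"]
        by (simp add: bounded_clinear_simps[OF R] tensor2_simps(3,4)[OF s])
      then show ?case
        using Cons.IH by (simp add: xy bounded_clinear_simps[OF R] tensor2_simps(1)[OF s])
    qed
    then show ?thesis
      by (simp add: l A_def m_def bounded_clinear_simps[OF R] tensor2_simps(1)[OF s]
          comp_def case_prod_unfold)
  qed
  have pyth: "(norm (\<Sum>(x, y)\<leftarrow>l. s (R x) y))\<^sup>2
      = (norm (R A) * norm b)\<^sup>2 + (norm (\<Sum>(x, y)\<leftarrow>m. s (R x) y))\<^sup>2"
    if R: "bounded_clinear R" for R :: "'a \<Rightarrow> 'a"
    using orth[of m "R A" R, OF m_orth] unfolding split[OF R]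
    by (simp add: norm_add_Pythagorean orthogonal_def inner_eq_Re_cinner tensor2_simps(8)[OF s])
  have o: "onorm S \<ge> 0" using S by (intro onorm_pos_le bounded_clinear_imp_bounded_linear)
  have "(norm (\<Sum>(x, y)\<leftarrow>l. s (S x) y))\<^sup>2
      = (norm (S A) * norm b)\<^sup>2 + (norm (\<Sum>(x, y)\<leftarrow>m. s (S x) y))\<^sup>2"
    by (rule pyth[OF S])
  also have "\<dots> \<le> (onorm S * norm A * norm b)\<^sup>2 + (onorm S * norm (\<Sum>(x, y)\<leftarrow>m. s x y))\<^sup>2"
    using Suc(1)[of m] l(2)
    by (intro add_mono power_mono mult_right_mono bounded_clinear_simps(8)[OF S]) (auto simp: m_def)
  also have "\<dots> = (onorm S * norm (\<Sum>(x, y)\<leftarrow>l. s x y))\<^sup>2"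
    using pyth[OF bounded_clinear_ident] by (simp add: power_mult_distrib algebra_simps)
  finally show ?case using o by (auto intro: power2_le_imp_le)
qed

lemma tensor2_span_list:
  assumes s: "hilbert_tensor2 s" and "v \<in> cspan (range (\<lambda>(x, y). s x y))"
  shows "\<exists>l. v = (\<Sum>(x, y)\<leftarrow>l. s x y)"
  using assms(2)
proof (induction rule: complex_vector.span_induct_alt)
  case base
  show ?case by (intro exI[of _ "[]"]) simp
next
  case (step c u v)
  then obtain x y l where "u = s x y" "v = (\<Sum>(x, y)\<leftarrow>l. s x y)" by auto
  then show ?case by (intro exI[of _ "(c *\<^sub>C x, y) # l"]) (simp add: tensor2_simps(3)[OF s])
qed

text \<open>The norm bound on finite sums of elementary tensors shows both that applying
  \<open>S\<close> to the first factors is well defined and that it extends to the whole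
  space.\<close>

lemma op_tensor_id_right:
  assumes s: "hilbert_tensor2 s" and S: "bounded_clinear S"
  shows "bounded_clinear (op_tensor s S id)" "op_tensor s S id (s x y) = s (S x) y"
    "onorm (op_tensor s S id) \<le> onorm S"
proof -
  \<comment> \<open>The graph is indexed by lists, that is by representations of vectors;
    independence of the representation comes out of the extension lemma.\<close>
  define D where "D = range (\<lambda>l. (\<Sum>(x, y)\<leftarrow>l. s x y, \<Sum>(x, y)\<leftarrow>l. s (S x) y))"
  have "\<exists>X. bounded_clinear X \<and> (\<forall>(v, w)\<in>D. X v = w) \<and> (\<forall>v. norm (X v) \<le> onorm S * norm v)"
  proof (rule bounded_clinear_extension)
    fix v w v' w' assume "(v, w) \<in> D" "(v', w') \<in> D"
    then obtain l l' where "v = (\<Sum>(x, y)\<leftarrow>l. s x y)" "w = (\<Sum>(x, y)\<leftarrow>l. s (S x) y)"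
      "v' = (\<Sum>(x, y)\<leftarrow>l'. s x y)" "w' = (\<Sum>(x, y)\<leftarrow>l'. s (S x) y)" unfolding D_def by auto
    then show "(v + v', w + w') \<in> D" unfolding D_def by (intro image_eqI[of _ _ "l @ l'"]) auto
  next
    fix c v w assume "(v, w) \<in> D"
    then obtain l where l: "v = (\<Sum>(x, y)\<leftarrow>l. s x y)" "w = (\<Sum>(x, y)\<leftarrow>l. s (S x) y)"
      unfolding D_def by auto
    have "c *\<^sub>C (\<Sum>(x, y)\<leftarrow>l. s (R x) y)
        = (\<Sum>(x, y)\<leftarrow>map (\<lambda>(x, y). (c *\<^sub>C x, y)) l. s (R x) y)" if "bounded_clinear R" for R :: "'a \<Rightarrow> 'a"
      by (induction l) (auto simp: scaleC_add_right bounded_clinear_simps[OF that] tensor2_simps(3)[OF s])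
    from this[OF S] this[OF bounded_clinear_ident] show "(c *\<^sub>C v, c *\<^sub>C w) \<in> D"
      unfolding D_def l by (intro image_eqI[of _ _ "map (\<lambda>(x, y). (c *\<^sub>C x, y)) l"]) auto
  next
    show "norm w \<le> onorm S * norm v" if "(v, w) \<in> D" for v w
      using that tensor2_finite_sum_bound[OF s S] unfolding D_def by auto
    have "cspan (range (\<lambda>(x, y). s x y)) \<subseteq> fst ` D"
      using tensor2_span_list[OF s] unfolding D_def image_image by fastforce
    from closure_mono[OF this] show "closure (fst ` D) = UNIV" using tensor2_dense[OF s] by auto
  qed
  then obtain X where X: "bounded_clinear X" "\<And>v w. (v, w) \<in> D \<Longrightarrow> X v = w"
    "\<And>v. norm (X v) \<le> onorm S * norm v" by (elim exE conjE) fast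
  have Xs: "X (s x y) = s (S x) y" for x y
    by (rule X(2)) (auto simp: D_def intro!: image_eqI[of _ _ "[(x, y)]"])
  then have eq: "op_tensor s S id = X" by (intro op_tensor_eq[OF s X(1)]) simp
  show "bounded_clinear (op_tensor s S id)" "op_tensor s S id (s x y) = s (S x) y"
    unfolding eq by (fact X(1) Xs)+
  show "onorm (op_tensor s S id) \<le> onorm S" unfolding eq
    using X(3) onorm_pos_le[OF bounded_clinear_imp_bounded_linear[OF S]] by (intro onorm_bound)
qed

text \<open>Exchanging the two factors reduces this to an operator on the first factor.\<close>

lemma op_tensor_id_left:
  assumes s: "hilbert_tensor2 s" and R: "bounded_clinear R"
  shows "bounded_clinear (op_tensor s id R)" "op_tensor s id R (s x y) = s x (R y)"
proof -
  have "op_tensor s id R = op_tensor (\<lambda>y x. s x y) R id"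
    using op_tensor_id_right[OF tensor2_swap[OF s] R] by (intro op_tensor_eq[OF s]) auto
  then show "bounded_clinear (op_tensor s id R)" "op_tensor s id R (s x y) = s x (R y)"
    using op_tensor_id_right[OF tensor2_swap[OF s] R] by auto
qed

text \<open>Test on \<open>s x \<psi>\<close>. With the opposite inequality, ampliation preserves
  the norm, which transfers the norm condition on the summands of a macroscopic observable.\<close>

lemma onorm_le_op_tensor_id:
  fixes s :: "'a::chilbert_space \<Rightarrow> 'h::chilbert_space \<Rightarrow> 'c::chilbert_space" and \<psi> :: 'h
  assumes s: "hilbert_tensor2 s" and S: "bounded_clinear S" and "norm \<psi> = 1"
  shows "onorm S \<le> onorm (op_tensor s S id)"
proof (rule onorm_bound)
  show "0 \<le> onorm (op_tensor s S id)"
    by (intro onorm_pos_le bounded_clinear_imp_bounded_linear op_tensor_id_right(1)[OF s S])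
  fix x
  have "norm (S x) = norm (op_tensor s S id (s x \<psi>))"
    using assms(3) by (simp add: op_tensor_id_right[OF s S] tensor2_simps(8)[OF s])
  also have "\<dots> \<le> onorm (op_tensor s S id) * norm (s x \<psi>)"
    by (intro bounded_clinear_simps(8) op_tensor_id_right(1)[OF s S])
  finally show "norm (S x) \<le> onorm (op_tensor s S id) * norm x"
    using assms(3) by (simp add: tensor2_simps(8)[OF s])
qed

lemma self_adjoint_op_tensor_id:
  assumes s: "hilbert_tensor2 s" and S: "bounded_clinear S" "self_adjoint S"
  shows "self_adjoint (op_tensor s S id)"
  using op_tensor_id_right(1)[OF s S(1)] tensor2_dense[OF s]
proof (rule self_adjoint_on_dense)
  fix u v assume "u \<in> range (\<lambda>(x, y). s x y)" "v \<in> range (\<lambda>(x, y). s x y)"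
  then obtain x y x' y' where "u = s x y" "v = s x' y'" by auto
  then show "cinner (op_tensor s S id u) v = cinner u (op_tensor s S id v)"
    using S(2) by (simp add: op_tensor_id_right(2)[OF s S(1)] tensor2_simps(5)[OF s] self_adjoint_def)
qed

section \<open>The trace of the evolved state\<close>

lemma cadjoint_eq:
  assumes "\<And>x y. cinner (S x) y = cinner x (R y)"
  shows "cadjoint S = R"
  unfolding cadjoint_def
proof (rule the_equality)
  fix R' assume "\<forall>x y. cinner (S x) y = cinner x (R' y)"
  then show "R' = R" using assms by (intro ext cinner_ext) metis
qed (use assms in blast)

lemma tensor2_slice:
  assumes s: "hilbert_tensor2 s"
  shows "bounded_clinear (\<lambda>x. s x \<psi>)"
  by (rule bounded_clinearI[where M = "norm \<psi>"]) (simp_all add: tensor2_simps[OF s])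

text \<open>Write \<open>V x = s x \<psi>\<close>. Its adjoint \<open>K\<close> contracts the second
  factor with \<psi>, and \<tau> \<otimes> |\<psi>><\<psi>| is the composition of \<open>V\<close>,
  \<tau> and \<open>K\<close>. This factorisation gives both the existence of the tensor product and
  the form in which its trace is computed.\<close>

lemma op_tensor_ketbra:
  assumes s: "hilbert_tensor2 s" and \<tau>: "bounded_clinear \<tau>"
  shows "bounded_clinear (op_tensor s \<tau> (ketbra \<psi> \<psi>))"
    and "op_tensor s \<tau> (ketbra \<psi> \<psi>) (s x y) = s (\<tau> x) (ketbra \<psi> \<psi> y)"
    and "\<exists>K. (\<forall>x y. cinner (s x \<psi>) y = cinner x (K y)) \<and>
      op_tensor s \<tau> (ketbra \<psi> \<psi>) = (\<lambda>v. s (\<tau> (K v)) \<psi>)"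
proof -
  obtain K where K: "bounded_clinear K" "\<And>x y. cinner (s x \<psi>) y = cinner x (K y)"
    using adjoint_exists[OF tensor2_slice[OF s, of \<psi>]] by blast
  have K_s: "K (s x y) = cinner \<psi> y *\<^sub>C x" for x y
    by (rule cinner_ext) (simp add: K(2)[symmetric] tensor2_simps(5)[OF s] cinner_simps)
  have b: "bounded_clinear (\<lambda>v. s (\<tau> (K v)) \<psi>)"
    using bounded_clinear_compose[OF tensor2_slice[OF s] bounded_clinear_compose[OF \<tau> K(1)]] .
  have e: "s (\<tau> (K (s x y))) \<psi> = s (\<tau> x) (ketbra \<psi> \<psi> y)" for x y
    by (simp add: K_s ketbra_def bounded_clinear_simps[OF \<tau>] tensor2_simps(3,4)[OF s])
  have eq: "op_tensor s \<tau> (ketbra \<psi> \<psi>) = (\<lambda>v. s (\<tau> (K v)) \<psi>)"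
    by (rule op_tensor_eq[OF s b]) (rule e)
  show "bounded_clinear (op_tensor s \<tau> (ketbra \<psi> \<psi>))"
    "op_tensor s \<tau> (ketbra \<psi> \<psi>) (s x y) = s (\<tau> x) (ketbra \<psi> \<psi> y)"
    unfolding eq by (fact b e)+
  show "\<exists>K. (\<forall>x y. cinner (s x \<psi>) y = cinner x (K y)) \<and>
      op_tensor s \<tau> (ketbra \<psi> \<psi>) = (\<lambda>v. s (\<tau> (K v)) \<psi>)"
    using K(2) eq by blast
qed

lemma op_tensor_mixture:
  assumes s: "hilbert_tensor2 s" and \<tau>: "bounded_clinear \<tau>"
  shows "op_tensor s \<tau> (\<lambda>x. p *\<^sub>R ketbra \<phi> \<phi> x + q *\<^sub>R ketbra \<psi> \<psi> x)
    = (\<lambda>v. p *\<^sub>R op_tensor s \<tau> (ketbra \<phi> \<phi>) v + q *\<^sub>R op_tensor s \<tau> (ketbra \<psi> \<psi>) v)"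
proof (rule op_tensor_eq[OF s])
  show "bounded_clinear
      (\<lambda>v. p *\<^sub>R op_tensor s \<tau> (ketbra \<phi> \<phi>) v + q *\<^sub>R op_tensor s \<tau> (ketbra \<psi> \<psi>) v)"
    by (intro bounded_clinear_add bounded_clinear_scaleR op_tensor_ketbra(1)[OF s \<tau>])
qed (simp add: op_tensor_ketbra(2)[OF s \<tau>] tensor2_simps(2,4)[OF s] scaleR_scaleC)

section \<open>The unitary evolution and its trace formula\<close>

lemma unitary_norm:
  assumes "unitary U"
  shows "norm (U x) = norm x"
proof -
  have "complex_of_real ((norm (U x))\<^sup>2) = complex_of_real ((norm x)\<^sup>2)"
    using assms by (simp only: cinner_self[symmetric] unitary_def)
  then show ?thesis unfolding of_real_eq_iff by simp
qed

lemma unitary_cadjoint: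
  assumes U: "unitary U"
  shows "bounded_clinear (cadjoint U)" "cinner (U x) y = cinner x (cadjoint U y)"
proof -
  have "bounded_clinear U" using U by (simp add: unitary_def)
  then obtain R where R: "bounded_clinear R" "\<And>x y. cinner (U x) y = cinner x (R y)"
    using adjoint_exists by blast
  with cadjoint_eq[OF R(2)]
  show "bounded_clinear (cadjoint U)" "cinner (U x) y = cinner x (cadjoint U y)" by auto
qed

text \<open>With \<tau> = \<Sum>_k |g_k><g_k| the evolved operator is \<Sum>_k |u_k><u_k|, where u_k
  = U (g_k \<otimes> \<psi>). Composed with \<open>X\<close> it becomes \<Sum>_k |u_k><Y u_k| with
  \<open>Y\<close> the adjoint of \<open>X\<close>, a rank one series whose trace is known.\<close>

lemma evolution_has_trace:
  fixes s :: "'a::chilbert_space \<Rightarrow> 'h::chilbert_space \<Rightarrow> 'c::chilbert_space"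
  assumes s: "hilbert_tensor2 s" and U: "unitary U" and \<tau>: "bounded_clinear \<tau>"
    and X: "bounded_clinear X"
    and g: "\<And>x y. ((\<lambda>k. cinner x (g k) * cinner (g k) y) has_sum cinner x (\<tau> y)) UNIV"
    and g2: "(\<lambda>k::nat. (norm (g k))\<^sup>2) summable_on UNIV"
  shows "((\<lambda>e. cinner e (evolution s U \<tau> (ketbra \<psi> \<psi>) (X e)))
      has_sum (\<Sum>\<^sub>\<infinity>k. cinner (U (s (g k) \<psi>)) (X (U (s (g k) \<psi>))))) some_onb"
    and "(\<lambda>k. cinner (U (s (g k) \<psi>)) (X (U (s (g k) \<psi>)))) summable_on UNIV"
proof -
  obtain K where K: "\<And>x y. cinner (s x \<psi>) y = cinner x (K y)"
    "op_tensor s \<tau> (ketbra \<psi> \<psi>) = (\<lambda>v. s (\<tau> (K v)) \<psi>)"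
    using op_tensor_ketbra(3)[OF s \<tau>] by blast
  obtain Y where Y: "\<And>x y. cinner (X x) y = cinner x (Y y)" "\<And>x. norm (Y x) \<le> onorm X * norm x"
    using adjoint_exists[OF X] by blast
  have Y': "cinner (Y x) y = cinner x (X y)" for x y by (metis Y(1) cinner_commute)
  define u where "u k = U (s (g k) \<psi>)" for k
  have norm_u: "norm (u k) = norm (g k) * norm \<psi>" for k
    by (simp add: u_def unitary_norm[OF U] tensor2_simps(8)[OF s])
  have u2: "(\<lambda>k. (norm (u k))\<^sup>2) summable_on UNIV"
    using summable_on_cmult_left[OF g2] by (simp add: norm_u power_mult_distrib)
  have v2: "(\<lambda>k. (norm (Y (u k)))\<^sup>2) summable_on UNIV"
  proof (rule summable_on_comparison_test)
    show "(\<lambda>k. (norm (u k))\<^sup>2 * (onorm X)\<^sup>2) summable_on UNIV"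
      using summable_on_cmult_left[OF u2] .
    show "(norm (Y (u k)))\<^sup>2 \<le> (norm (u k))\<^sup>2 * (onorm X)\<^sup>2" for k
      using power_mono[OF Y(2)[of "u k"], of 2] by (simp add: power_mult_distrib mult.commute)
  qed auto
  have h: "((\<lambda>k. cinner e (u k) * cinner (Y (u k)) e)
      has_sum cinner e (evolution s U \<tau> (ketbra \<psi> \<psi>) (X e))) UNIV" for e
  proof -
    have adj: "cinner (g k) (K (cadjoint U y)) = cinner (u k) y" for k y
      by (simp add: u_def unitary_cadjoint(2)[OF U] K(1))
    have adj': "cinner (K (cadjoint U y)) (g k) = cinner y (u k)" for k y
      by (metis adj cinner_commute)
    \<comment> \<open>\<open>\<lambda>y. K (cadjoint U y)\<close> is the adjoint of
      \<open>\<lambda>x. U (s x \<psi>)\<close>, so the series of \<tau> can be inserted between its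
      values.\<close>
    have "cinner e (evolution s U \<tau> (ketbra \<psi> \<psi>) (X e))
        = cinner (K (cadjoint U e)) (\<tau> (K (cadjoint U (X e))))"
      by (simp add: evolution_def K(2))
         (metis K(1) unitary_cadjoint(2)[OF U] cinner_commute)
    then show ?thesis
      using g[of "K (cadjoint U e)" "K (cadjoint U (X e))"] by (simp add: adj adj' Y')
  qed
  show "((\<lambda>e. cinner e (evolution s U \<tau> (ketbra \<psi> \<psi>) (X e)))
      has_sum (\<Sum>\<^sub>\<infinity>k. cinner (U (s (g k) \<psi>)) (X (U (s (g k) \<psi>))))) some_onb"
    "(\<lambda>k. cinner (U (s (g k) \<psi>)) (X (U (s (g k) \<psi>)))) summable_on UNIV"
    using rank_one_series_trace[OF some_onb_is_onb u2 v2 h] unfolding Y' u_def by auto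
qed

section \<open>The commutator estimate\<close>

text \<open>Cauchy-Schwarz over the index \<open>k\<close>, where \<open>a\<close> and
  \<open>b\<close> are the l2 norms of the two families. It is applied on finite sets with a uniform
  bound, which also yields summability.\<close>

lemma l2_pairing_bound:
  fixes p :: "'i \<Rightarrow> 'a::real_normed_vector" and q :: "'i \<Rightarrow> 'b::real_normed_vector"
    and h :: "'i \<Rightarrow> complex"
  assumes p: "((\<lambda>k. (norm (p k))\<^sup>2) has_sum a\<^sup>2) I" and q: "((\<lambda>k. (norm (q k))\<^sup>2) has_sum b\<^sup>2) I"
    and h: "\<And>k. cmod (h k) \<le> c * (norm (p k) * norm (q k))"
    and nonneg: "a \<ge> 0" "b \<ge> 0" "c \<ge> 0"
  shows "h summable_on I" "cmod (infsum h I) \<le> c * (a * b)"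
proof -
  have fin: "(\<Sum>k\<in>F. cmod (h k)) \<le> c * (a * b)" if F: "finite F" "F \<subseteq> I" for F
  proof -
    have part: "L2_set (\<lambda>k. norm (r k)) F \<le> d"
      if r: "((\<lambda>k. (norm (r k))\<^sup>2) has_sum d\<^sup>2) I" and d: "d \<ge> 0" for r :: "'i \<Rightarrow> 'z::real_normed_vector" and d
    proof -
      have "(\<Sum>k\<in>F. (norm (r k))\<^sup>2) \<le> infsum (\<lambda>k. (norm (r k))\<^sup>2) I"
        using r F by (intro finite_sum_le_infsum) (auto simp: summable_on_def)
      also have "\<dots> = d\<^sup>2" using r by (rule infsumI)
      finally show ?thesis unfolding L2_set_def using d by (intro real_le_lsqrt) auto
    qed
    have "(\<Sum>k\<in>F. cmod (h k)) \<le> c * (\<Sum>k\<in>F. \<bar>norm (p k)\<bar> * \<bar>norm (q k)\<bar>)"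
      unfolding sum_distrib_left using h by (intro sum_mono) simp
    also have "\<dots> \<le> c * (L2_set (\<lambda>k. norm (p k)) F * L2_set (\<lambda>k. norm (q k)) F)"
      by (intro mult_left_mono L2_set_mult_ineq nonneg)
    also have "\<dots> \<le> c * (a * b)"
      by (intro mult_left_mono mult_mono part[OF p] part[OF q] nonneg L2_set_nonneg)
    finally show ?thesis .
  qed
  have abs: "(\<lambda>k. norm (h k)) summable_on I"
    using fin by (intro nonneg_bdd_above_summable_on bdd_aboveI2[where M = "c * (a * b)"]) auto
  then show "h summable_on I" by (rule Infinite_Sum.abs_summable_summable)
  have "cmod (infsum h I) \<le> (\<Sum>\<^sub>\<infinity>k\<in>I. norm (h k))" using abs by (rule norm_infsum_bound)
  also have "\<dots> \<le> c * (a * b)" using abs fin by (rule infsum_le_finite_sums)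
  finally show "cmod (infsum h I) \<le> c * (a * b)" .
qed

text \<open>For a state \<Sum>_k |u_k><u_k| the variance is the total squared norm of the vectors (B
  - b) u_k: expand the square and use that the squared norms of the u_k sum to 1.\<close>

lemma variance_has_sum:
  fixes u :: "'i \<Rightarrow> 'c::chilbert_space"
  assumes B: "bounded_clinear B" "self_adjoint B"
    and u: "((\<lambda>k. (norm (u k))\<^sup>2) has_sum 1) I"
    and b: "((\<lambda>k. Re (cinner (u k) (B (u k)))) has_sum b) I"
    and v: "((\<lambda>k. Re (cinner (u k) (B (B (u k))))) has_sum (\<sigma>\<^sup>2 + b\<^sup>2)) I"
  shows "((\<lambda>k. (norm (B (u k) - b *\<^sub>R u k))\<^sup>2) has_sum \<sigma>\<^sup>2) I"
proof -
  have "(norm (B x - b *\<^sub>R x))\<^sup>2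
      = Re (cinner x (B (B x))) + (- 2 * b) * Re (cinner x (B x)) + b\<^sup>2 * (norm x)\<^sup>2" for x
  proof -
    have "(norm (B x - b *\<^sub>R x))\<^sup>2 = Re (cinner (B x - b *\<^sub>R x) (B x - b *\<^sub>R x))"
      by (simp add: cinner_self)
    also have "\<dots> = Re (cinner x (B (B x))) + (- 2 * b) * Re (cinner x (B x)) + b\<^sup>2 * Re (cinner x x)"
      using B(2) by (simp add: cinner_simps self_adjoint_def power2_eq_square algebra_simps)
    finally show ?thesis by (simp add: cinner_self)
  qed
  moreover have "\<sigma>\<^sup>2 + b\<^sup>2 + (- 2 * b) * b + b\<^sup>2 * 1 = \<sigma>\<^sup>2" by (simp add: power2_eq_square)
  ultimately show ?thesis
    using has_sum_add[OF has_sum_add[OF v has_sum_cmult_right[OF b, of "- 2 * b"]]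
        has_sum_cmult_right[OF u, of "b\<^sup>2"]] by simp
qed

text \<open>Moving \<open>B - b\<^sub>0\<close> onto \<open>u\<close> and \<open>B - b\<^sub>1\<close> onto \<open>v\<close> in \<open>\<langle>v, [A, B] u\<rangle>\<close> leaves
  \<open>(b\<^sub>0 - b\<^sub>1) \<langle>v, A u\<rangle>\<close>.\<close>

lemma commutator_estimate:
  fixes u v :: "'i \<Rightarrow> 'c::chilbert_space"
  assumes A: "bounded_clinear A" and B: "bounded_clinear B" "self_adjoint B"
    and u: "((\<lambda>k. (norm (u k))\<^sup>2) has_sum 1) I" and v: "((\<lambda>k. (norm (v k))\<^sup>2) has_sum 1) I"
    and \<sigma>\<^sub>0: "((\<lambda>k. (norm (B (u k) - b\<^sub>0 *\<^sub>R u k))\<^sup>2) has_sum \<sigma>\<^sub>0\<^sup>2) I" "\<sigma>\<^sub>0 \<ge> 0"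
    and \<sigma>\<^sub>1: "((\<lambda>k. (norm (B (v k) - b\<^sub>1 *\<^sub>R v k))\<^sup>2) has_sum \<sigma>\<^sub>1\<^sup>2) I" "\<sigma>\<^sub>1 \<ge> 0"
    and C: "\<And>x. norm (A (B x) - B (A x)) \<le> C * norm x" "C \<ge> 0"
  shows "(\<lambda>k. cinner (v k) (A (u k))) summable_on I"
    and "\<bar>b\<^sub>0 - b\<^sub>1\<bar> * cmod (\<Sum>\<^sub>\<infinity>k\<in>I. cinner (v k) (A (u k))) \<le> C + (\<sigma>\<^sub>0 + \<sigma>\<^sub>1) * onorm A"
proof -
  have A0: "onorm A \<ge> 0" using A by (intro onorm_pos_le bounded_clinear_imp_bounded_linear)
  have u1: "((\<lambda>k. (norm (u k))\<^sup>2) has_sum 1\<^sup>2) I" and v1: "((\<lambda>k. (norm (v k))\<^sup>2) has_sum 1\<^sup>2) I"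
    using u v by simp_all
  have bd: "cmod (cinner x (A y)) \<le> onorm A * (norm x * norm y)" for x y
  proof -
    have "cmod (cinner x (A y)) \<le> norm x * norm (A y)" by (rule cinner_cauchy_schwarz)
    also have "\<dots> \<le> norm x * (onorm A * norm y)"
      by (intro mult_left_mono bounded_clinear_simps(8)[OF A]) simp
    finally show ?thesis by (simp add: mult_ac)
  qed
  have bd': "cmod (cinner x (A (B y) - B (A y))) \<le> C * (norm x * norm y)" for x y
  proof -
    have "cmod (cinner x (A (B y) - B (A y))) \<le> norm x * norm (A (B y) - B (A y))"
      by (rule cinner_cauchy_schwarz)
    also have "\<dots> \<le> norm x * (C * norm y)" by (intro mult_left_mono C) simp
    finally show ?thesis by (simp add: mult_ac)
  qed
  show "(\<lambda>k. cinner (v k) (A (u k))) summable_on I"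
    by (rule l2_pairing_bound(1)[OF v1 u1 bd]) (use A0 in auto)
  \<comment> \<open>The l2 norms paired in \<open>S1\<close>, \<open>S2\<close>, \<open>S3\<close>
    are 1 and 1, then 1 and \<open>\<sigma>\<^sub>0\<close>, then \<open>\<sigma>\<^sub>1\<close>
    and 1; the constants are \<open>C\<close>, \<open>onorm A\<close> and
    \<open>onorm A\<close>.\<close>
  define S1 where "S1 = (\<lambda>k. cinner (v k) (A (B (u k)) - B (A (u k))))"
  define S2 where "S2 = (\<lambda>k. cinner (v k) (A (B (u k) - b\<^sub>0 *\<^sub>R u k)))"
  define S3 where "S3 = (\<lambda>k. cinner (B (v k) - b\<^sub>1 *\<^sub>R v k) (A (u k)))"
  have S1: "S1 summable_on I" "cmod (infsum S1 I) \<le> C * (1 * 1)"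
    unfolding S1_def
    by (intro l2_pairing_bound[OF v1 u1 bd']; use C(2) in simp)+
  have S2: "S2 summable_on I" "cmod (infsum S2 I) \<le> onorm A * (1 * \<sigma>\<^sub>0)"
    unfolding S2_def
    by (intro l2_pairing_bound[OF v1 \<sigma>\<^sub>0(1) bd]; use A0 \<sigma>\<^sub>0(2) in simp)+
  have S3: "S3 summable_on I" "cmod (infsum S3 I) \<le> onorm A * (\<sigma>\<^sub>1 * 1)"
    unfolding S3_def
    by (intro l2_pairing_bound[OF \<sigma>\<^sub>1(1) u1 bd]; use A0 \<sigma>\<^sub>1(2) in simp)+
  \<comment> \<open>Self-adjointness moves \<open>B\<close> across in \<open>S3\<close>; the terms
    with \<open>A (B (u k))\<close> and \<open>B (A (u k))\<close> then cancel and only the scalar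
    shifts remain.\<close>
  have "S1 k - S2 k + S3 k = complex_of_real (b\<^sub>0 - b\<^sub>1) * cinner (v k) (A (u k))" for k
    using B(2) unfolding S1_def S2_def S3_def
    by (simp add: cinner_simps bounded_clinear_simps[OF A] self_adjoint_def algebra_simps)
  then have "complex_of_real (b\<^sub>0 - b\<^sub>1) * (\<Sum>\<^sub>\<infinity>k\<in>I. cinner (v k) (A (u k)))
      = infsum (\<lambda>k. S1 k - S2 k + S3 k) I"
    by (simp add: infsum_cmult_right')
  also have "\<dots> = infsum S1 I - infsum S2 I + infsum S3 I"
    using S1(1) S2(1) S3(1)
    unfolding diff_conv_add_uminus by (intro infsumI has_sum_add has_sum_uminusI has_sum_infsum)
  finally have "cmod (complex_of_real (b\<^sub>0 - b\<^sub>1) * (\<Sum>\<^sub>\<infinity>k\<in>I. cinner (v k) (A (u k))))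
      \<le> cmod (infsum S1 I) + cmod (infsum S2 I) + cmod (infsum S3 I)"
    by (metis norm_triangle_le norm_triangle_ineq4 add_mono order_refl)
  then show "\<bar>b\<^sub>0 - b\<^sub>1\<bar> * cmod (\<Sum>\<^sub>\<infinity>k\<in>I. cinner (v k) (A (u k))) \<le> C + (\<sigma>\<^sub>0 + \<sigma>\<^sub>1) * onorm A"
    using S1(2) S2(2) S3(2) unfolding norm_mult norm_of_real by (simp add: algebra_simps)
qed

section \<open>Commutators of microscopic and macroscopic observables\<close>

text \<open>On elementary tensors the two products of inner products differ only in factor
  \<open>i\<close>, where the operator is symmetric; symmetry on this total set suffices.\<close>

lemma acts_on_factor_self_adjoint:
  assumes t: "hilbert_tensor I F t" and i: "i \<in> I" and X: "acts_on_factor I F t i X"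
  shows "bounded_clinear X" "self_adjoint X"
proof -
  show bX: "bounded_clinear X" using X by (simp add: acts_on_factor_def)
  obtain Y where Y: "observable_on (F i) Y" "\<And>x. x \<in> PiE I F \<Longrightarrow> X (t x) = t (x(i := Y (x i)))"
    using X unfolding acts_on_factor_def by blast
  have upd: "x(i := Y (x i)) \<in> PiE I F" if "x \<in> PiE I F" for x
    using that i Y(1) unfolding observable_on_def by (auto simp: PiE_def extensional_def Pi_def)
  have ip: "cinner (t x) (t y) = (\<Prod>j\<in>I. cinner (x j) (y j))" if "x \<in> PiE I F" "y \<in> PiE I F" for x y
    using t that unfolding hilbert_tensor_def by blast
  have "closure (cspan (t ` PiE I F)) = UNIV" using t unfolding hilbert_tensor_def by blast
  with bX show "self_adjoint X"
  proof (rule self_adjoint_on_dense)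
    fix a b assume "a \<in> t ` PiE I F" "b \<in> t ` PiE I F"
    then obtain x y where xy: "x \<in> PiE I F" "y \<in> PiE I F" "a = t x" "b = t y" by blast
    have "cinner (Y (x i)) (y i) = cinner (x i) (Y (y i))"
      using Y(1) xy(1,2) i unfolding observable_on_def by (metis PiE_mem)
    then have "(\<Prod>j\<in>I. cinner ((x(i := Y (x i))) j) (y j))
        = (\<Prod>j\<in>I. cinner (x j) ((y(i := Y (y i))) j))"
      by (intro prod.cong) auto
    then show "cinner (X a) b = cinner a (X b)" using xy by (simp add: Y(2) ip upd)
  qed
qed

text \<open>On elementary tensors the operators are updates at different coordinates, which
  commute.\<close>

lemma acts_on_factor_commute:
  assumes t: "hilbert_tensor I F t" and ij: "i \<in> I" "j \<in> I" "i \<noteq> j"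
    and X: "acts_on_factor I F t i X" and Z: "acts_on_factor I F t j Z"
  shows "X (Z v) = Z (X v)"
proof -
  obtain Y where Y: "observable_on (F i) Y" "\<And>x. x \<in> PiE I F \<Longrightarrow> X (t x) = t (x(i := Y (x i)))"
    using X unfolding acts_on_factor_def by blast
  obtain W where W: "observable_on (F j) W" "\<And>x. x \<in> PiE I F \<Longrightarrow> Z (t x) = t (x(j := W (x j)))"
    using Z unfolding acts_on_factor_def by blast
  have b: "bounded_clinear X" "bounded_clinear Z" using X Z by (simp_all add: acts_on_factor_def)
  have upd: "x(i := Y (x i)) \<in> PiE I F" "x(j := W (x j)) \<in> PiE I F" if "x \<in> PiE I F" for x
    using that ij Y(1) W(1) unfolding observable_on_def by (auto simp: PiE_def extensional_def Pi_def)
  have "(\<lambda>v. X (Z v)) = (\<lambda>v. Z (X v))"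
  proof (rule eq_on_dense)
    show "closure (cspan (t ` PiE I F)) = UNIV" using t unfolding hilbert_tensor_def by blast
    fix v assume "v \<in> t ` PiE I F"
    then obtain x where "x \<in> PiE I F" "v = t x" by blast
    then show "X (Z v) = Z (X v)" using ij(3) upd[of x] by (simp add: Y(2) W(2) fun_upd_twist)
  qed (rule bounded_clinear_compose[OF b] bounded_clinear_compose[OF b(2,1)])+
  then show ?thesis by (rule fun_cong)
qed

section \<open>Commutators after adjoining factor 0\<close>

lemma acts_on_factor_ext_bounded:
  assumes "hilbert_tensor2 s" "acts_on_factor_ext N F t s i A"
  shows "bounded_clinear A"
  using assms(2) op_tensor_id_right(1)[OF assms(1)] op_tensor_id_left(1)[OF assms(1)]
  by (auto simp: acts_on_factor_ext_def acts_on_factor_def observable_def split: if_splits)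

text \<open>For \<open>i = 0\<close> the operator \<open>A\<close> acts on the second tensor factor
  and \<open>Z\<close> on the first; otherwise both are ampliations of operators on different
  factors among 1, ..., N.\<close>

lemma acts_on_factor_ext_commute:
  assumes t: "hilbert_tensor {1..N} F t" and s: "hilbert_tensor2 s"
    and A: "acts_on_factor_ext N F t s i A" and i: "i \<in> {0..N}"
    and Z: "acts_on_factor {1..N} F t j Z" and j: "j \<in> {1..N}" "j \<noteq> i"
  shows "A (op_tensor s Z id v) = op_tensor s Z id (A v)"
proof -
  have bZ: "bounded_clinear Z" using Z by (simp add: acts_on_factor_def)
  note sZ = op_tensor_id_right[OF s bZ]
  have bA: "bounded_clinear A" using s A by (rule acts_on_factor_ext_bounded)
  have "(\<lambda>v. A (op_tensor s Z id v)) = (\<lambda>v. op_tensor s Z id (A v))"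
  proof (rule eq_on_tensor2[OF s])
    fix x y
    show "A (op_tensor s Z id (s x y)) = op_tensor s Z id (A (s x y))"
    proof (cases "i = 0")
      case True
      then obtain X where "bounded_clinear X" "A = op_tensor s id X"
        using A by (auto simp: acts_on_factor_ext_def observable_def)
      then show ?thesis by (simp add: sZ(2) op_tensor_id_left[OF s])
    next
      case False
      then obtain X where X: "acts_on_factor {1..N} F t i X" "A = op_tensor s X id"
        using A by (auto simp: acts_on_factor_ext_def)
      then have "bounded_clinear X" by (simp add: acts_on_factor_def)
      moreover have "X (Z x) = Z (X x)"
        using False i j by (intro acts_on_factor_commute[OF t _ _ _ X(1) Z]) auto
      ultimately show ?thesis by (simp add: sZ(2) X(2) op_tensor_id_right[OF s])
    qed
  qed (rule bounded_clinear_compose[OF bA sZ(1)] bounded_clinear_compose[OF sZ(1) bA])+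
  then show ?thesis by (rule fun_cong)
qed

text \<open>The ampliation keeps the weight 1/N and has no summand at factor 0. The unit vector
  serves to replace \<open>onorm B'\<close> by the norm of the ampliation of \<open>B'\<close> in
  the bounds for the summands.\<close>

lemma macroscopic_op_tensor_id:
  fixes s :: "'a::chilbert_space \<Rightarrow> 'h::chilbert_space \<Rightarrow> 'c::chilbert_space" and \<psi> :: 'h
  assumes t: "hilbert_tensor {1..N} F t" and s: "hilbert_tensor2 s"
    and B': "macroscopic {1..N} (acts_on_factor {1..N} F t) B'" and \<psi>: "norm \<psi> = 1"
  shows "bounded_clinear (op_tensor s B' id)" "self_adjoint (op_tensor s B' id)"
    and "\<exists>Z. (\<forall>i\<in>{1..N}. acts_on_factor {1..N} F t i (Z i)
          \<and> onorm (op_tensor s (Z i) id) \<le> onorm (op_tensor s B' id))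
        \<and> op_tensor s B' id = (\<lambda>v. (1 / real N) *\<^sub>R (\<Sum>i\<in>{1..N}. op_tensor s (Z i) id v))"
proof -
  obtain Z where Z: "\<And>i. i \<in> {1..N} \<Longrightarrow> acts_on_factor {1..N} F t i (Z i)"
    "\<And>i. i \<in> {1..N} \<Longrightarrow> onorm (Z i) \<le> onorm B'"
    "B' = (\<lambda>v. (1 / real N) *\<^sub>R (\<Sum>i\<in>{1..N}. Z i v))"
    using B' unfolding macroscopic_def card_atLeastAtMost add_diff_cancel_right' Suc_eq_plus1 by blast
  have bZ: "bounded_clinear (Z i)" "self_adjoint (Z i)" if "i \<in> {1..N}" for i
    using acts_on_factor_self_adjoint[OF t that Z(1)[OF that]] by auto
  have bB': "bounded_clinear B'"
    unfolding Z(3) by (intro bounded_clinear_scaleR bounded_clinear_sum bZ)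
  have "self_adjoint B'"
    using bZ(2) unfolding Z(3) self_adjoint_def by (auto simp: cinner_simps intro!: sum.cong)
  with bB' show "bounded_clinear (op_tensor s B' id)" "self_adjoint (op_tensor s B' id)"
    by (auto intro: op_tensor_id_right(1)[OF s] self_adjoint_op_tensor_id[OF s])
  have "onorm (op_tensor s (Z i) id) \<le> onorm (op_tensor s B' id)" if "i \<in> {1..N}" for i
    using op_tensor_id_right(3)[OF s bZ(1)[OF that]] Z(2)[OF that] onorm_le_op_tensor_id[OF s bB' \<psi>]
    by linarith
  moreover have "op_tensor s B' id = (\<lambda>v. (1 / real N) *\<^sub>R (\<Sum>i\<in>{1..N}. op_tensor s (Z i) id v))"
  proof (rule op_tensor_eq[OF s])
    show "bounded_clinear (\<lambda>v. (1 / real N) *\<^sub>R (\<Sum>i\<in>{1..N}. op_tensor s (Z i) id v))"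
      by (intro bounded_clinear_scaleR bounded_clinear_sum op_tensor_id_right(1)[OF s] bZ(1))
    fix x y
    have "s (B' x) y = (1 / real N) *\<^sub>R (\<Sum>i\<in>{1..N}. s (Z i x) y)"
      unfolding Z(3) by (simp add: bounded_clinear_simps[OF tensor2_slice[OF s]])
    then show "(1 / real N) *\<^sub>R (\<Sum>i\<in>{1..N}. op_tensor s (Z i) id (s x y)) = s (B' x) (id y)"
      by (simp only: op_tensor_id_right(2)[OF s bZ(1)] id_apply cong: sum.cong)
  qed
  ultimately show "\<exists>Z. (\<forall>i\<in>{1..N}. acts_on_factor {1..N} F t i (Z i)
          \<and> onorm (op_tensor s (Z i) id) \<le> onorm (op_tensor s B' id))
        \<and> op_tensor s B' id = (\<lambda>v. (1 / real N) *\<^sub>R (\<Sum>i\<in>{1..N}. op_tensor s (Z i) id v))"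
    using Z(1) by blast
qed

text \<open>The commutators with summands at factors other than \<open>i\<close> vanish. At most one
  remains, with weight 1/N and operator norm at most \<open>2 * onorm B * onorm A\<close>; for
  \<open>i = 0\<close> none remains.\<close>

lemma microscopic_commutator_bound:
  fixes s :: "'a::chilbert_space \<Rightarrow> 'h::chilbert_space \<Rightarrow> 'c::chilbert_space" and \<psi> :: 'h
  assumes t: "hilbert_tensor {1..N} F t" and s: "hilbert_tensor2 s"
    and B': "macroscopic {1..N} (acts_on_factor {1..N} F t) B'" and \<psi>: "norm \<psi> = 1"
    and A: "acts_on_factor_ext N F t s i A" and i: "i \<in> {0..N}"
    and B: "B = op_tensor s B' id"
  shows "norm (A (B v) - B (A v)) \<le> 2 / real N * onorm B * onorm A * norm v"
proof -
  obtain Z where Z: "\<And>j. j \<in> {1..N} \<Longrightarrow> acts_on_factor {1..N} F t j (Z j)"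
    "\<And>j. j \<in> {1..N} \<Longrightarrow> onorm (op_tensor s (Z j) id) \<le> onorm B"
    "B = (\<lambda>v. (1 / real N) *\<^sub>R (\<Sum>j\<in>{1..N}. op_tensor s (Z j) id v))"
    using macroscopic_op_tensor_id(3)[OF t s B' \<psi>] unfolding B by blast
  define W where "W j = op_tensor s (Z j) id" for j
  have bA: "bounded_clinear A" using s A by (rule acts_on_factor_ext_bounded)
  have bB: "bounded_clinear B" unfolding B by (rule macroscopic_op_tensor_id(1)[OF t s B' \<psi>])
  have A0: "onorm A \<ge> 0" and B0: "onorm B \<ge> 0"
    using bA bB by (auto intro: onorm_pos_le bounded_clinear_imp_bounded_linear)
  have bW: "bounded_clinear (W j)" if "j \<in> {1..N}" for j
    using Z(1)[OF that] op_tensor_id_right(1)[OF s] by (auto simp: W_def acts_on_factor_def)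
  have comm: "A (W j v) - W j (A v) = (if j = i then A (W i v) - W i (A v) else 0)"
    if "j \<in> {1..N}" for j
    using acts_on_factor_ext_commute[OF t s A i Z(1)[OF that] that] by (simp add: W_def)
  have B_eq: "B w = (1 / real N) *\<^sub>R (\<Sum>j\<in>{1..N}. W j w)" for w
    unfolding Z(3) W_def ..
  have "A (B v) - B (A v) = (1 / real N) *\<^sub>R (\<Sum>j\<in>{1..N}. A (W j v) - W j (A v))"
    by (simp only: B_eq bounded_clinear_simps(6,7)[OF bA] sum_subtractf scaleR_diff_right)
  also have "\<dots> = (1 / real N) *\<^sub>R (if i \<in> {1..N} then A (W i v) - W i (A v) else 0)"
  proof -
    have "(\<Sum>j\<in>{1..N}. A (W j v) - W j (A v))
        = (\<Sum>j\<in>{1..N}. if j = i then A (W i v) - W i (A v) else 0)"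
      using comm by (rule sum.cong[OF refl])
    then show ?thesis by simp
  qed
  finally have eq: "A (B v) - B (A v)
      = (1 / real N) *\<^sub>R (if i \<in> {1..N} then A (W i v) - W i (A v) else 0)" .
  show ?thesis
  proof (cases "i \<in> {1..N}")
    case False
    then show ?thesis using A0 B0 unfolding eq if_not_P[OF False] by simp
  next
    case True
    have W_le: "norm (W i x) \<le> onorm B * norm x" for x
      using bounded_clinear_simps(8)[OF bW[OF True], of x] Z(2)[OF True]
      by (metis W_def mult_right_mono norm_ge_zero order_trans)
    have "norm (A (W i v)) \<le> onorm A * norm (W i v)" by (rule bounded_clinear_simps(8)[OF bA])
    also have "\<dots> \<le> onorm A * (onorm B * norm v)" by (intro mult_left_mono W_le A0)
    finally have 1: "norm (A (W i v)) \<le> onorm B * onorm A * norm v" by (simp add: mult_ac)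
    have "norm (W i (A v)) \<le> onorm B * norm (A v)" by (rule W_le)
    also have "\<dots> \<le> onorm B * (onorm A * norm v)"
      by (intro mult_left_mono bounded_clinear_simps(8)[OF bA] B0)
    finally have 2: "norm (W i (A v)) \<le> onorm B * onorm A * norm v" by (simp add: mult_ac)
    have "norm (A (W i v) - W i (A v)) \<le> 2 * (onorm B * onorm A * norm v)"
      using norm_triangle_ineq4[of "A (W i v)" "W i (A v)"] 1 2 by linarith
    then have "norm (A (W i v) - W i (A v)) / real N \<le> 2 * (onorm B * onorm A * norm v) / real N"
      by (intro divide_right_mono) auto
    then show ?thesis unfolding eq using True by (simp add: mult_ac)
  qed
qed

text \<open>A macroscopic \<open>A\<close> averages N + 1 summands of norm at most
  \<open>onorm A\<close>, each obeying the microscopic bound; averaging preserves that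
  bound.\<close>

lemma commutator_bound:
  fixes s :: "'a::chilbert_space \<Rightarrow> 'h::chilbert_space \<Rightarrow> 'c::chilbert_space" and \<psi> :: 'h
  assumes t: "hilbert_tensor {1..N} F t" and s: "hilbert_tensor2 s"
    and B': "macroscopic {1..N} (acts_on_factor {1..N} F t) B'" and \<psi>: "norm \<psi> = 1"
    and A: "microscopic {0..N} (acts_on_factor_ext N F t s) A \<or>
      macroscopic {0..N} (acts_on_factor_ext N F t s) A"
    and B: "B = op_tensor s B' id"
  shows "bounded_clinear A" "norm (A (B v) - B (A v)) \<le> 2 / real N * onorm B * onorm A * norm v"
proof -
  note micro = microscopic_commutator_bound[OF t s B' \<psi> _ _ B]
  have bB: "bounded_clinear B" unfolding B by (rule macroscopic_op_tensor_id(1)[OF t s B' \<psi>])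
  have B0: "onorm B \<ge> 0" using bB by (intro onorm_pos_le bounded_clinear_imp_bounded_linear)
  have "bounded_clinear A \<and> norm (A (B v) - B (A v)) \<le> 2 / real N * onorm B * onorm A * norm v"
    using A
  proof
    assume "microscopic {0..N} (acts_on_factor_ext N F t s) A"
    then show ?thesis using micro acts_on_factor_ext_bounded[OF s] unfolding microscopic_def by blast
  next
    assume "macroscopic {0..N} (acts_on_factor_ext N F t s) A"
    then obtain Z where Z: "\<And>i. i \<in> {0..N} \<Longrightarrow> acts_on_factor_ext N F t s i (Z i)"
      "\<And>i. i \<in> {0..N} \<Longrightarrow> onorm (Z i) \<le> onorm A"
      "A = (\<lambda>v. (1 / real (Suc N)) *\<^sub>R (\<Sum>i\<in>{0..N}. Z i v))"
      unfolding macroscopic_def card_atLeastAtMost diff_zero by blast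
    define M where "M = 2 / real N * onorm B * onorm A * norm v"
    have "norm (Z i (B v) - B (Z i v)) \<le> M" if i: "i \<in> {0..N}" for i
    proof -
      have "norm (Z i (B v) - B (Z i v)) \<le> 2 / real N * onorm B * onorm (Z i) * norm v"
        by (rule micro[OF Z(1)[OF i] i])
      also have "\<dots> \<le> M"
        unfolding M_def using B0 by (intro mult_right_mono mult_left_mono Z(2)[OF i]) auto
      finally show ?thesis .
    qed
    then have "(\<Sum>i\<in>{0..N}. norm (Z i (B v) - B (Z i v))) \<le> (\<Sum>i\<in>{0..N}. M)" by (rule sum_mono)
    then have sum_le: "norm (\<Sum>i\<in>{0..N}. Z i (B v) - B (Z i v)) \<le> real (Suc N) * M"
      using norm_sum order_trans by fastforce
    have "A (B v) - B (A v) = (1 / real (Suc N)) *\<^sub>R (\<Sum>i\<in>{0..N}. Z i (B v) - B (Z i v))"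
      unfolding Z(3) by (simp only: bounded_clinear_simps[OF bB] sum_subtractf scaleR_diff_right)
    then have "norm (A (B v) - B (A v)) = norm (\<Sum>i\<in>{0..N}. Z i (B v) - B (Z i v)) / real (Suc N)"
      by simp
    also have "\<dots> \<le> real (Suc N) * M / real (Suc N)" by (intro divide_right_mono sum_le) simp
    finally have "norm (A (B v) - B (A v)) \<le> M" by simp
    moreover have "bounded_clinear A"
      unfolding Z(3)
      by (intro bounded_clinear_scaleR bounded_clinear_sum acts_on_factor_ext_bounded[OF s Z(1)])
    ultimately show ?thesis unfolding M_def by blast
  qed
  then show "bounded_clinear A" "norm (A (B v) - B (A v)) \<le> 2 / real N * onorm B * onorm A * norm v"
    by auto
qed

section \<open>Comparison of the evolved superposition with the evolved mixture\<close>

theorem mainTheorem2: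
  fixes N :: nat
    and F :: "nat \<Rightarrow> 'k::chilbert_space set"
    and t :: "(nat \<Rightarrow> 'k) \<Rightarrow> 'a::chilbert_space"
    and s :: "'a \<Rightarrow> 'h::chilbert_space \<Rightarrow> 'c::chilbert_space"
    and \<psi>\<^sub>0 \<psi>\<^sub>1 :: 'h
    and \<tau> B' :: "'a \<Rightarrow> 'a"
    and U B :: "'c \<Rightarrow> 'c"
    and T :: "('h \<Rightarrow> 'h) \<Rightarrow> 'c \<Rightarrow> 'c"
    and b\<^sub>0 b\<^sub>1 \<sigma>\<^sub>0 \<sigma>\<^sub>1 :: real
  assumes "N \<ge> 1"
    and "hilbert_tensor {1..N} F t"
    and "hilbert_tensor2 s"
    and "norm \<psi>\<^sub>0 = 1" and "norm \<psi>\<^sub>1 = 1" and "cinner \<psi>\<^sub>0 \<psi>\<^sub>1 = 0"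
    and "state \<tau>"
    and "unitary U"
    and "T = evolution s U \<tau>"
    and "macroscopic {1..N} (acts_on_factor {1..N} F t) B'"
    and "B = op_tensor s B' id"
    and "b\<^sub>0 = expected_value (T (ketbra \<psi>\<^sub>0 \<psi>\<^sub>0)) B"
    and "b\<^sub>1 = expected_value (T (ketbra \<psi>\<^sub>1 \<psi>\<^sub>1)) B"
    and "\<sigma>\<^sub>0 \<ge> 0" and "\<sigma>\<^sub>0\<^sup>2 = op_variance (T (ketbra \<psi>\<^sub>0 \<psi>\<^sub>0)) B"
    and "\<sigma>\<^sub>1 \<ge> 0" and "\<sigma>\<^sub>1\<^sup>2 = op_variance (T (ketbra \<psi>\<^sub>1 \<psi>\<^sub>1)) B"
    and "b\<^sub>0 \<noteq> b\<^sub>1"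
  shows "\<forall>\<alpha>\<^sub>0 \<alpha>\<^sub>1 \<psi> A.
    (cmod \<alpha>\<^sub>0)\<^sup>2 + (cmod \<alpha>\<^sub>1)\<^sup>2 = 1 \<longrightarrow>
    \<psi> = \<alpha>\<^sub>0 *\<^sub>C \<psi>\<^sub>0 + \<alpha>\<^sub>1 *\<^sub>C \<psi>\<^sub>1 \<longrightarrow>
    microscopic {0..N} (acts_on_factor_ext N F t s) A \<or>
    macroscopic {0..N} (acts_on_factor_ext N F t s) A \<longrightarrow>
    cmod (op_trace (T (ketbra \<psi> \<psi>) \<circ> A)
          - op_trace (T (\<lambda>x. (cmod \<alpha>\<^sub>0)\<^sup>2 *\<^sub>R ketbra \<psi>\<^sub>0 \<psi>\<^sub>0 x
                          + (cmod \<alpha>\<^sub>1)\<^sup>2 *\<^sub>R ketbra \<psi>\<^sub>1 \<psi>\<^sub>1 x) \<circ> A))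
      \<le> (2 / real N * onorm B + \<sigma>\<^sub>0 + \<sigma>\<^sub>1) / \<bar>b\<^sub>0 - b\<^sub>1\<bar> * onorm A"
proof -
  note s = assms(3)
  have \<tau>: "positive_op \<tau>" "op_trace \<tau> = 1" using \<open>state \<tau>\<close> by (simp_all add: state_def)
  have b\<tau>: "bounded_clinear \<tau>" using \<tau>(1) by (simp add: positive_op_def)
  \<comment> \<open>An infinite sum over a non-summable family has the default value 0, so trace 1
    forces summability.\<close>
  have "(\<lambda>e. cinner e (\<tau> e)) summable_on some_onb"
    using \<tau>(2) unfolding op_trace_def by (metis infsum_not_exists zero_neq_one)
  from positive_op_rank_one_series[OF \<tau>(1) some_onb_is_onb this]
  obtain g where g: "\<And>x y. ((\<lambda>k. cinner x (g k) * cinner (g k) y) has_sum cinner x (\<tau> y)) UNIV"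
    and g1: "((\<lambda>k::nat. (norm (g k))\<^sup>2) has_sum 1) UNIV"
    using \<tau>(2) unfolding op_trace_def[symmetric] by auto
  have g2: "(\<lambda>k. (norm (g k))\<^sup>2) summable_on UNIV" using g1 unfolding summable_on_def by blast
  have bU: "bounded_clinear U" using \<open>unitary U\<close> by (simp add: unitary_def)
  \<comment> \<open>The evolved operator for \<psi> is \<Sum>_k |w_k><w_k| with w_k =
    \<open>w \<psi> k\<close>; linearity of \<open>w\<close> in \<psi> produces the cross
    terms.\<close>
  define w where "w \<psi> k = U (s (g k) \<psi>)" for \<psi> k
  have w1: "((\<lambda>k. (norm (w \<psi> k))\<^sup>2) has_sum 1) UNIV" if "norm \<psi> = 1" for \<psi>
    using g1 that by (simp add: w_def unitary_norm[OF \<open>unitary U\<close>] tensor2_simps(8)[OF s])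
  have w_lin: "w (\<alpha> *\<^sub>C \<phi> + \<beta> *\<^sub>C \<psi>) k = \<alpha> *\<^sub>C w \<phi> k + \<beta> *\<^sub>C w \<psi> k" for \<alpha> \<beta> \<phi> \<psi> k
    by (simp add: w_def tensor2_simps(2,4)[OF s] bounded_clinear_simps(1,5)[OF bU])
  note trace = evolution_has_trace[OF s \<open>unitary U\<close> b\<tau> _ g g2, folded w_def, folded \<open>T = evolution s U \<tau>\<close>]
  have tr: "op_trace (T (ketbra \<psi> \<psi>) \<circ> X) = (\<Sum>\<^sub>\<infinity>k. cinner (w \<psi> k) (X (w \<psi> k)))"
    if "bounded_clinear X" for \<psi> X
    unfolding op_trace_def comp_def by (rule infsumI, rule trace(1)[OF that])
  have B: "bounded_clinear B" "self_adjoint B"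
    unfolding \<open>B = op_tensor s B' id\<close> by (fact macroscopic_op_tensor_id(1,2)[OF assms(2) s assms(10,4)])+
  have BB: "bounded_clinear (B \<circ> B)" unfolding comp_def by (rule bounded_clinear_compose[OF B(1) B(1)])
  have Re_sum: "((\<lambda>k. Re (cinner (w \<psi> k) (X (w \<psi> k)))) has_sum Re (op_trace (T (ketbra \<psi> \<psi>) \<circ> X))) UNIV"
    if "bounded_clinear X" for \<psi> X
    unfolding tr[OF that]
    by (rule has_sum_bounded_linear[OF bounded_linear_Re has_sum_infsum[OF trace(2)[OF that]]])
  have var: "((\<lambda>k. (norm (B (w \<psi> k) - b *\<^sub>R w \<psi> k))\<^sup>2) has_sum \<sigma>\<^sup>2) UNIV"
    if "norm \<psi> = 1" "b = expected_value (T (ketbra \<psi> \<psi>)) B"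
      "\<sigma>\<^sup>2 = op_variance (T (ketbra \<psi> \<psi>)) B" for \<psi> b \<sigma>
  proof (rule variance_has_sum[OF B w1[OF that(1)]])
    show "((\<lambda>k. Re (cinner (w \<psi> k) (B (w \<psi> k)))) has_sum b) UNIV"
      using Re_sum[OF B(1)] that(2) by (simp add: expected_value_def)
    show "((\<lambda>k. Re (cinner (w \<psi> k) (B (B (w \<psi> k))))) has_sum (\<sigma>\<^sup>2 + b\<^sup>2)) UNIV"
      using Re_sum[OF BB] that(2,3) by (simp add: op_variance_def)
  qed
  note var0 = var[OF assms(4,12,15)] and var1 = var[OF assms(5,13,17)]
  show ?thesis
  proof (intro allI impI)
    fix \<alpha>\<^sub>0 \<alpha>\<^sub>1 \<psi> A
    assume \<alpha>: "(cmod \<alpha>\<^sub>0)\<^sup>2 + (cmod \<alpha>\<^sub>1)\<^sup>2 = 1" and \<psi>: "\<psi> = \<alpha>\<^sub>0 *\<^sub>C \<psi>\<^sub>0 + \<alpha>\<^sub>1 *\<^sub>C \<psi>\<^sub>1"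
      and A: "microscopic {0..N} (acts_on_factor_ext N F t s) A \<or>
        macroscopic {0..N} (acts_on_factor_ext N F t s) A"
    note comm = commutator_bound[OF assms(2) s assms(10,4) A \<open>B = op_tensor s B' id\<close>]
    define C where "C = 2 / real N * onorm B * onorm A"
    define R where "R = (2 / real N * onorm B + \<sigma>\<^sub>0 + \<sigma>\<^sub>1) / \<bar>b\<^sub>0 - b\<^sub>1\<bar> * onorm A"
    have A0: "onorm A \<ge> 0" and B0: "onorm B \<ge> 0"
      using comm(1) B(1) by (auto intro: onorm_pos_le bounded_clinear_imp_bounded_linear)
    then have C: "C \<ge> 0" by (simp add: C_def)
    have "R \<ge> 0" using A0 B0 assms(14,16) by (simp add: R_def)
    let ?P = "\<lambda>\<phi> \<eta>. \<Sum>\<^sub>\<infinity>k. cinner (w \<phi> k) (A (w \<eta> k))"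
    have diff_pos: "\<bar>b\<^sub>0 - b\<^sub>1\<bar> > 0" using \<open>b\<^sub>0 \<noteq> b\<^sub>1\<close> by simp
    \<comment> \<open>\<open>R\<close> is the bound to be proved; multiplied by the gap between the
      expected values it is the right-hand side of the commutator estimate, for either order of the
      two vectors.\<close>
    have R_eq: "C + (\<sigma>\<^sub>0 + \<sigma>\<^sub>1) * onorm A = \<bar>b\<^sub>0 - b\<^sub>1\<bar> * R" "C + (\<sigma>\<^sub>1 + \<sigma>\<^sub>0) * onorm A = \<bar>b\<^sub>1 - b\<^sub>0\<bar> * R"
      using diff_pos by (simp_all add: R_def C_def field_simps abs_minus_commute)
    \<comment> \<open>The estimate is applied once for each cross term, with the roles of
      \<open>\<psi>\<^sub>0\<close> and \<open>\<psi>\<^sub>1\<close> exchanged.\<close>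
    note est10 = commutator_estimate[OF comm(1) B w1[OF assms(4)] w1[OF assms(5)]
        var0 assms(14) var1 assms(16) comm(2)[folded C_def] C]
    note est01 = commutator_estimate[OF comm(1) B w1[OF assms(5)] w1[OF assms(4)]
        var1 assms(16) var0 assms(14) comm(2)[folded C_def] C]
    have P10: "cmod (?P \<psi>\<^sub>1 \<psi>\<^sub>0) \<le> R" and P01: "cmod (?P \<psi>\<^sub>0 \<psi>\<^sub>1) \<le> R"
      using est10(2) est01(2) diff_pos unfolding R_eq by (simp_all add: abs_minus_commute)
    have "op_trace (T (ketbra \<psi> \<psi>) \<circ> A) = (\<Sum>\<^sub>\<infinity>k. cinner (w \<psi> k) (A (w \<psi> k)))"
      by (rule tr[OF comm(1)])
    \<comment> \<open>Sesquilinear expansion: the diagonal terms are those of the mixture, so only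
      the bracket of cross terms survives the subtraction.\<close>
    also have "\<dots> = (cmod \<alpha>\<^sub>0)\<^sup>2 * ?P \<psi>\<^sub>0 \<psi>\<^sub>0 + (cmod \<alpha>\<^sub>1)\<^sup>2 * ?P \<psi>\<^sub>1 \<psi>\<^sub>1
        + (cnj \<alpha>\<^sub>0 * \<alpha>\<^sub>1 * ?P \<psi>\<^sub>0 \<psi>\<^sub>1 + cnj \<alpha>\<^sub>1 * \<alpha>\<^sub>0 * ?P \<psi>\<^sub>1 \<psi>\<^sub>0)"
    proof (rule infsumI)
      have "cinner (w \<psi> k) (A (w \<psi> k))
          = (cmod \<alpha>\<^sub>0)\<^sup>2 * cinner (w \<psi>\<^sub>0 k) (A (w \<psi>\<^sub>0 k)) + (cmod \<alpha>\<^sub>1)\<^sup>2 * cinner (w \<psi>\<^sub>1 k) (A (w \<psi>\<^sub>1 k))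
            + (cnj \<alpha>\<^sub>0 * \<alpha>\<^sub>1 * cinner (w \<psi>\<^sub>0 k) (A (w \<psi>\<^sub>1 k))
              + cnj \<alpha>\<^sub>1 * \<alpha>\<^sub>0 * cinner (w \<psi>\<^sub>1 k) (A (w \<psi>\<^sub>0 k)))" for k
        unfolding \<psi> w_lin complex_norm_square
        by (simp add: bounded_clinear_simps(1,5)[OF comm(1)] cinner_simps algebra_simps)
      then show "((\<lambda>k. cinner (w \<psi> k) (A (w \<psi> k))) has_sum
          (cmod \<alpha>\<^sub>0)\<^sup>2 * ?P \<psi>\<^sub>0 \<psi>\<^sub>0 + (cmod \<alpha>\<^sub>1)\<^sup>2 * ?P \<psi>\<^sub>1 \<psi>\<^sub>1
          + (cnj \<alpha>\<^sub>0 * \<alpha>\<^sub>1 * ?P \<psi>\<^sub>0 \<psi>\<^sub>1 + cnj \<alpha>\<^sub>1 * \<alpha>\<^sub>0 * ?P \<psi>\<^sub>1 \<psi>\<^sub>0)) UNIV"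
        by (simp only:) (intro has_sum_add has_sum_cmult_right has_sum_infsum
            trace(2)[OF comm(1)] est10(1) est01(1))
    qed
    finally have lhs: "op_trace (T (ketbra \<psi> \<psi>) \<circ> A) = \<dots>" .
    have rhs: "op_trace (T (\<lambda>x. (cmod \<alpha>\<^sub>0)\<^sup>2 *\<^sub>R ketbra \<psi>\<^sub>0 \<psi>\<^sub>0 x
        + (cmod \<alpha>\<^sub>1)\<^sup>2 *\<^sub>R ketbra \<psi>\<^sub>1 \<psi>\<^sub>1 x) \<circ> A)
        = (cmod \<alpha>\<^sub>0)\<^sup>2 * ?P \<psi>\<^sub>0 \<psi>\<^sub>0 + (cmod \<alpha>\<^sub>1)\<^sup>2 * ?P \<psi>\<^sub>1 \<psi>\<^sub>1"
      unfolding op_trace_def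
    proof (rule infsumI)
      have "T (\<lambda>x. (cmod \<alpha>\<^sub>0)\<^sup>2 *\<^sub>R ketbra \<psi>\<^sub>0 \<psi>\<^sub>0 x + (cmod \<alpha>\<^sub>1)\<^sup>2 *\<^sub>R ketbra \<psi>\<^sub>1 \<psi>\<^sub>1 x) y
          = (cmod \<alpha>\<^sub>0)\<^sup>2 *\<^sub>R T (ketbra \<psi>\<^sub>0 \<psi>\<^sub>0) y + (cmod \<alpha>\<^sub>1)\<^sup>2 *\<^sub>R T (ketbra \<psi>\<^sub>1 \<psi>\<^sub>1) y" for y
        unfolding \<open>T = evolution s U \<tau>\<close> evolution_def op_tensor_mixture[OF s b\<tau>]
        by (simp add: bounded_clinear_simps(1,6)[OF bU])
      then show "((\<lambda>e. cinner e ((T (\<lambda>x. (cmod \<alpha>\<^sub>0)\<^sup>2 *\<^sub>R ketbra \<psi>\<^sub>0 \<psi>\<^sub>0 x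
          + (cmod \<alpha>\<^sub>1)\<^sup>2 *\<^sub>R ketbra \<psi>\<^sub>1 \<psi>\<^sub>1 x) \<circ> A) e)) has_sum
          (cmod \<alpha>\<^sub>0)\<^sup>2 * ?P \<psi>\<^sub>0 \<psi>\<^sub>0 + (cmod \<alpha>\<^sub>1)\<^sup>2 * ?P \<psi>\<^sub>1 \<psi>\<^sub>1) some_onb"
        unfolding comp_def
        by (simp only: cinner_add_right cinner_scaleR_right)
           (intro has_sum_add has_sum_cmult_right trace(1)[OF comm(1)])
    qed
    have "cmod (cnj \<alpha>\<^sub>0 * \<alpha>\<^sub>1 * ?P \<psi>\<^sub>0 \<psi>\<^sub>1 + cnj \<alpha>\<^sub>1 * \<alpha>\<^sub>0 * ?P \<psi>\<^sub>1 \<psi>\<^sub>0)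
        \<le> cmod (cnj \<alpha>\<^sub>0 * \<alpha>\<^sub>1 * ?P \<psi>\<^sub>0 \<psi>\<^sub>1) + cmod (cnj \<alpha>\<^sub>1 * \<alpha>\<^sub>0 * ?P \<psi>\<^sub>1 \<psi>\<^sub>0)"
      by (rule norm_triangle_ineq)
    also have "\<dots> \<le> cmod \<alpha>\<^sub>0 * cmod \<alpha>\<^sub>1 * R + cmod \<alpha>\<^sub>1 * cmod \<alpha>\<^sub>0 * R"
      unfolding norm_mult complex_mod_cnj by (intro add_mono mult_left_mono P01 P10) auto
    also have "\<dots> = 2 * cmod \<alpha>\<^sub>0 * cmod \<alpha>\<^sub>1 * R" by simp
    \<comment> \<open>The weight \<open>2 * cmod \<alpha>\<^sub>0 * cmod \<alpha>\<^sub>1\<close> is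
      at most \<open>(cmod \<alpha>\<^sub>0)\<^sup>2 + (cmod \<alpha>\<^sub>1)\<^sup>2\<close>,
      which is 1, so the two cross terms together cost only one \<open>R\<close>.\<close>
    also have "\<dots> \<le> 1 * R"
      using sum_squares_bound[of "cmod \<alpha>\<^sub>0" "cmod \<alpha>\<^sub>1"] \<alpha> \<open>R \<ge> 0\<close> by (intro mult_right_mono) auto
    finally show "cmod (op_trace (T (ketbra \<psi> \<psi>) \<circ> A)
          - op_trace (T (\<lambda>x. (cmod \<alpha>\<^sub>0)\<^sup>2 *\<^sub>R ketbra \<psi>\<^sub>0 \<psi>\<^sub>0 x
                          + (cmod \<alpha>\<^sub>1)\<^sup>2 *\<^sub>R ketbra \<psi>\<^sub>1 \<psi>\<^sub>1 x) \<circ> A))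
      \<le> (2 / real N * onorm B + \<sigma>\<^sub>0 + \<sigma>\<^sub>1) / \<bar>b\<^sub>0 - b\<^sub>1\<bar> * onorm A"
      unfolding lhs rhs R_def[symmetric] by simp
  qed
qed

end
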